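(* Let $n,k\geq 1$. If $X\subseteq\mathbb{N}$ is finite, $\omega^{kn+3}$-large and $\min X\geq 17$, then $X$ is $\mathsf{RT}^2_k$-$\omega^n$-large, i.e. for every coloring $f:[X]^2\to k=\{0,\dots,k-1\}$ there is an $\omega^n$-large set $H\subseteq X$ on whose pairs $f$ is constant.
   Context: Fundamental sequences for ordinals $\alpha<\epsilon_0$: $\{0\}(x)=0$; for $\alpha\neq0$ write $\alpha=\beta+\omega^\gamma$ in Cantor normal form with $\omega^\gamma$ the last term; then $\{\alpha\}(x)=\beta$ if $\gamma=0$, $\beta+\omega^{\gamma'}\cdot x$ if $\gamma=\gamma'+1$, $\beta+\omega^{\{\gamma\}(x)}$ if $\gamma$ is a limit. For finite $X=\{x_0<\dots<x_s\}$, $\{\alpha\}(X)=\{\cdots\{\{\alpha\}(x_0)\}(x_1)\cdots\}(x_s)$, and $X$ is $\alpha$-large iff $\{\alpha\}(X)=0$. $[X]^2$ denotes the set of two-element subsets of $X$. *)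

theory Defs
  imports "HOL-Library.Ramsey" "HOL-Library.FuncSet"
begin

text \<open>
  Ordinals below \<open>\<epsilon>\<^sub>0\<close> are represented by their hereditary Cantor normal forms:
  \<open>CNF [\<gamma>\<^sub>1, \<dots>, \<gamma>\<^sub>r]\<close> stands for \<open>\<omega>\<^bsup>\<gamma>\<^sub>1\<^esup> + \<dots> + \<omega>\<^bsup>\<gamma>\<^sub>r\<^esup>\<close>, where repetitions of an exponent encode
  the coefficients and the empty list is \<open>0\<close>. The terms that denote Cantor normal forms are those
  with hereditarily non-increasing exponents, i.e. those satisfying \<open>is_cnf\<close> below; on these,
  equality of terms is equality of ordinals and \<open>ord_less\<close> is the order of the ordinals.
\<close>

datatype ord_cnf = CNF (exponents: "ord_cnf list")

abbreviation ord_zero :: ord_cnf where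
  "ord_zero \<equiv> CNF []"

fun ord_less :: "ord_cnf \<Rightarrow> ord_cnf \<Rightarrow> bool" where
  "ord_less a (CNF []) \<longleftrightarrow> False"
| "ord_less (CNF []) (CNF (b # bs)) \<longleftrightarrow> True"
| "ord_less (CNF (a # as)) (CNF (b # bs)) \<longleftrightarrow>
     ord_less a b \<or> a = b \<and> ord_less (CNF as) (CNF bs)"

fun is_cnf :: "ord_cnf \<Rightarrow> bool" where
  "is_cnf (CNF as) \<longleftrightarrow>
     (\<forall>a\<in>set as. is_cnf a) \<and> sorted_wrt (\<lambda>a b. ord_less b a \<or> a = b) as"

definition ord_of_nat :: "nat \<Rightarrow> ord_cnf" where
  "ord_of_nat m = CNF (replicate m ord_zero)"

definition omega_pow :: "ord_cnf \<Rightarrow> ord_cnf" where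
  "omega_pow \<gamma> = CNF [\<gamma>]"

text \<open>
  In the normal form \<open>\<beta> + \<omega>\<^bsup>\<gamma>\<^esup>\<close> of \<open>CNF as\<close> with \<open>as \<noteq> []\<close>, \<open>\<gamma>\<close> is \<open>last as\<close> and \<open>\<beta>\<close> is
  \<open>CNF (butlast as)\<close>. A nonzero \<open>\<gamma>\<close> is a successor \<open>\<gamma>' + 1\<close> iff its own last term is \<open>\<omega>\<^bsup>0\<^esup>\<close>,
  and then \<open>\<gamma>'\<close> arises by dropping that term.
\<close>

function fundseq :: "ord_cnf \<Rightarrow> nat \<Rightarrow> ord_cnf" where
  "fundseq (CNF as) x =
     (if as = [] then ord_zero
      else let \<beta> = butlast as; \<gamma> = last as in
        if \<gamma> = ord_zero then CNF \<beta>
        else if last (exponents \<gamma>) = ord_zero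
        then CNF (\<beta> @ replicate x (CNF (butlast (exponents \<gamma>))))
        else CNF (\<beta> @ [fundseq \<gamma> x]))"
  by pat_completeness auto
termination
proof (relation "measure (size \<circ> fst)")
  fix as :: "ord_cnf list" and x :: nat and \<beta> \<gamma>
  assume "as \<noteq> []" "\<gamma> = last as"
  then have "size \<gamma> < Suc (size_list size as)"
    by (metis last_in_set less_Suc_eq_le order_refl size_list_estimation')
  then show "((\<gamma>, x), (CNF as, x)) \<in> measure (size \<circ> fst)"
    by simp
qed simp

declare fundseq.simps [simp del]

definition fundseq_set :: "ord_cnf \<Rightarrow> nat set \<Rightarrow> ord_cnf" where
  "fundseq_set \<alpha> X = fold (\<lambda>x \<beta>. fundseq \<beta> x) (sorted_list_of_set X) \<alpha>"

definition large :: "ord_cnf \<Rightarrow> nat set \<Rightarrow> bool" where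
  "large \<alpha> X \<longleftrightarrow> finite X \<and> fundseq_set \<alpha> X = ord_zero"

definition RT2_large :: "nat \<Rightarrow> ord_cnf \<Rightarrow> nat set \<Rightarrow> bool" where
  "RT2_large k \<alpha> X \<longleftrightarrow>
     (\<forall>f \<in> [X]\<^bsup>2\<^esup> \<rightarrow> {..<k}. \<exists>H \<subseteq> X. large \<alpha> H \<and> (\<exists>c. \<forall>e \<in> [H]\<^bsup>2\<^esup>. f e = c))"

text \<open>
  The order is a strict linear order, and fundamental sequences stay inside the normal forms and
  are strictly below the given nonzero ordinal.
\<close>

lemma ord_less_irrefl: "\<not> ord_less a a"
proof -
  have "ord_less a b \<Longrightarrow> a \<noteq> b" for a b
    by (induction a b rule: ord_less.induct) auto
  then show ?thesis by blast
qed

lemma ord_less_trans: "ord_less a b \<Longrightarrow> ord_less b c \<Longrightarrow> ord_less a c"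
proof (induction a b arbitrary: c rule: ord_less.induct)
  case (2 b bs)
  then show ?case by (cases "(CNF [], c)" rule: ord_less.cases) auto
next
  case (3 a as b bs)
  obtain c' cs where c: "c = CNF (c' # cs)"
    using 3 by (cases "(CNF (b # bs), c)" rule: ord_less.cases) auto
  show ?case using 3 unfolding c by auto
qed simp

lemma ord_less_linear: "ord_less a b \<or> a = b \<or> ord_less b a"
proof (induction a b rule: ord_less.induct)
  case (1 a)
  then show ?case by (cases a rule: ord_cnf.exhaust; case_tac x) auto
qed auto

lemma ord_less_append: "ord_less (CNF as) (CNF bs) \<Longrightarrow> ord_less (CNF (cs @ as)) (CNF (cs @ bs))"
  by (induction cs) auto

lemma ord_less_snoc: "ord_less (CNF as) (CNF (as @ [b]))"
  by (induction as) auto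

lemma is_cnf_append:
  "is_cnf (CNF (as @ bs)) \<longleftrightarrow> is_cnf (CNF as) \<and> is_cnf (CNF bs) \<and>
     (\<forall>a\<in>set as. \<forall>b\<in>set bs. ord_less b a \<or> a = b)"
  by (auto simp: sorted_wrt_append)

lemma fundseq_less_is_cnf:
  "is_cnf \<alpha> \<Longrightarrow> is_cnf (fundseq \<alpha> x) \<and> (\<alpha> \<noteq> ord_zero \<longrightarrow> ord_less (fundseq \<alpha> x) \<alpha>)"
proof (induction \<alpha> x rule: fundseq.induct)
  case (1 as x)
  show ?case
  proof (cases "as = []")
    case True
    then show ?thesis by (simp add: fundseq.simps)
  next
    case False
    define \<beta> \<gamma> where "\<beta> = butlast as" and "\<gamma> = last as"
    have as: "as = \<beta> @ [\<gamma>]" using False by (simp add: \<beta>_def \<gamma>_def)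
    have cnf: "is_cnf (CNF \<beta>)" "is_cnf \<gamma>" "\<forall>a\<in>set \<beta>. ord_less \<gamma> a \<or> a = \<gamma>"
      using "1.prems" unfolding as is_cnf_append by auto
    have step: "is_cnf (CNF (\<beta> @ replicate m \<delta>)) \<and> ord_less (CNF (\<beta> @ replicate m \<delta>)) (CNF as)"
      if "is_cnf \<delta>" "ord_less \<delta> \<gamma>" for m \<delta>
    proof
      have "sorted_wrt (\<lambda>a b. ord_less b a \<or> a = b) (replicate m \<delta>)"
        by (induction m) auto
      then have "is_cnf (CNF (replicate m \<delta>))" using that by simp
      then show "is_cnf (CNF (\<beta> @ replicate m \<delta>))"
        unfolding is_cnf_append using cnf that ord_less_trans by auto
      have "ord_less (CNF (replicate m \<delta>)) (CNF [\<gamma>])"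
        using that by (cases m) auto
      then show "ord_less (CNF (\<beta> @ replicate m \<delta>)) (CNF as)"
        unfolding as by (rule ord_less_append)
    qed
    consider (zero) "\<gamma> = ord_zero"
      | (succ) "\<gamma> \<noteq> ord_zero" "last (exponents \<gamma>) = ord_zero"
      | (limit) "\<gamma> \<noteq> ord_zero" "last (exponents \<gamma>) \<noteq> ord_zero" by blast
    then show ?thesis
    proof cases
      case zero
      then have "fundseq (CNF as) x = CNF \<beta>" by (simp add: as fundseq.simps)
      then show ?thesis using cnf(1) ord_less_snoc unfolding as by metis
    next
      case succ
      define \<delta> where "\<delta> = butlast (exponents \<gamma>)"
      have \<gamma>: "\<gamma> = CNF (\<delta> @ [ord_zero])"
        using succ unfolding \<delta>_def
        by (metis append_butlast_last_id ord_cnf.collapse)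
      have "fundseq (CNF as) x = CNF (\<beta> @ replicate x (CNF \<delta>))"
        using succ by (simp add: as fundseq.simps \<delta>_def)
      moreover have "is_cnf (CNF \<delta>)" using cnf(2) unfolding \<gamma> is_cnf_append by blast
      moreover have "ord_less (CNF \<delta>) \<gamma>" unfolding \<gamma> by (rule ord_less_snoc)
      ultimately show ?thesis using step by metis
    next
      case limit
      have "fundseq (CNF as) x = CNF (\<beta> @ replicate 1 (fundseq \<gamma> x))"
        using limit by (subst fundseq.simps) (simp add: as)
      moreover have "is_cnf (fundseq \<gamma> x) \<and> ord_less (fundseq \<gamma> x) \<gamma>"
        using "1.IH"[OF False \<beta>_def \<gamma>_def] limit cnf(2) by blast
      ultimately show ?thesis using step by metis
    qed
  qed
qed

end

theory Submission
  imports Defs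
begin

text \<open>
  Say that \<open>X\<close> is \<open>\<omega>\<^bsup>e\<^esup>\<cdot>N\<close>-large if it contains \<open>N\<close> consecutive \<open>\<omega>\<^bsup>e\<^esup>\<close>-large blocks. Spending the
  factor \<open>\<omega>\<^sup>2\<close>, one passes to a subset whose elements grow triply exponentially. On such a sparse set,
  largeness survives partitions into few classes, so \<open>N\<close> blocks that are \<open>\<omega>\<^bsup>e+1\<^esup>\<close>-large can be thinned
  to blocks that are large for a big multiple of \<open>\<omega>\<^bsup>e\<^esup>\<close> and such that the colour of a pair of points
  from two different blocks depends only on the blocks. The finite Ramsey theorem gives many blocks
  with a single cross colour \<open>c\<close>. Hence it is enough to find, inside the blocks, either a set of
  colour \<open>c\<close> that is large for an exponent smaller by one, or a set of another colour that is
  already as large as desired. By induction on \<open>e = \<Sum>c<k. m c\<close>, every colouring of a sparse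
  \<open>\<omega>\<^bsup>e\<^esup>\<cdot>N\<close>-large set admits for some colour \<open>c\<close> a homogeneous set that is \<open>\<omega>\<^bsup>m c\<^esup>\<cdot>M\<close>-large, where
  \<open>N\<close> is a Ramsey number of \<open>2 * M\<close>. The theorem is the case \<open>m c = n\<close>, \<open>M = 1\<close>, \<open>N = 2\<close>.
\<close>

subsection \<open>Largeness by blocks\<close>

text \<open>
  Since \<open>lrg e\<close> lets the head of a block be any element, \<open>lrg e X\<close> says that some subset of \<open>X\<close> is
  \<open>\<omega>\<^bsup>e\<^esup>\<close>-large. This makes monotonicity under supersets trivial.
\<close>

definition before :: "nat set \<Rightarrow> nat set \<Rightarrow> bool" where
  "before A B \<longleftrightarrow> (\<forall>a\<in>A. \<forall>b\<in>B. a < b)"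

text \<open>The predicate \<open>P\<close> is a parameter so that blocks can be bundled:
  \<open>blk (blk P c) d\<close> describes \<open>d\<close> groups of \<open>c\<close> blocks. All
  pairs are compared because \<open>before\<close> is not transitive once empty sets occur.\<close>

definition blk :: "(nat set \<Rightarrow> bool) \<Rightarrow> nat \<Rightarrow> nat set \<Rightarrow> bool" where
  "blk P c X \<longleftrightarrow>
     (\<exists>Gs. length Gs = c \<and> sorted_wrt before Gs \<and> (\<forall>G\<in>set Gs. P G \<and> G \<subseteq> X))"

primrec lrg :: "nat \<Rightarrow> nat set \<Rightarrow> bool" where
  "lrg 0 X \<longleftrightarrow> X \<noteq> {}"
| "lrg (Suc e) X \<longleftrightarrow> (\<exists>x\<in>X. blk (lrg e) x {y \<in> X. x < y})"

lemma before_mono: "before A B \<Longrightarrow> A' \<subseteq> A \<Longrightarrow> B' \<subseteq> B \<Longrightarrow> before A' B'"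
  unfolding before_def by blast

lemma blk_mono:
  assumes "blk P c X" "X \<subseteq> Y" "d \<le> c"
  shows "blk P d Y"
proof -
  obtain Gs where "length Gs = c" "sorted_wrt before Gs" "\<forall>G\<in>set Gs. P G \<and> G \<subseteq> X"
    using assms(1) unfolding blk_def by blast
  then have "length (take d Gs) = d \<and> sorted_wrt before (take d Gs) \<and>
      (\<forall>G\<in>set (take d Gs). P G \<and> G \<subseteq> Y)"
    using assms(2,3) by (auto intro: sorted_wrt_take dest: in_set_takeD)
  then show ?thesis unfolding blk_def by blast
qed

lemma blk_0 [simp]: "blk P 0 X"
  unfolding blk_def by simp

lemma blk_1 [simp]: "blk P (Suc 0) X \<longleftrightarrow> (\<exists>G\<subseteq>X. P G)"
proof
  assume "blk P (Suc 0) X"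
  then obtain G where "\<forall>H\<in>set [G]. P H \<and> H \<subseteq> X"
    unfolding blk_def by (metis length_0_conv length_Suc_conv)
  then have "G \<subseteq> X \<and> P G" by simp
  then show "\<exists>G\<subseteq>X. P G" by (rule exI)
next
  assume "\<exists>G\<subseteq>X. P G"
  then obtain G where "G \<subseteq> X" "P G" by (elim exE conjE)
  then show "blk P (Suc 0) X"
    unfolding blk_def by (intro exI[of _ "[G]"]) simp
qed

lemma lrg_mono: "lrg e X \<Longrightarrow> X \<subseteq> Y \<Longrightarrow> lrg e Y"
proof (cases e)
  case (Suc e')
  assume "lrg e X" "X \<subseteq> Y"
  then obtain x where x: "x \<in> X" "blk (lrg e') x {y \<in> X. x < y}" using Suc by auto
  have "blk (lrg e') x {y \<in> Y. x < y}"
    by (rule blk_mono[OF x(2)]) (use \<open>X \<subseteq> Y\<close> in auto)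
  then show ?thesis using x \<open>X \<subseteq> Y\<close> Suc by auto
qed auto

lemma lrg_nonempty: "lrg e X \<Longrightarrow> X \<noteq> {}"
  by (cases e) auto

lemma blk_add:
  assumes "blk P (c + d) X"
  obtains Y Z where "Y \<subseteq> X" "Z \<subseteq> X" "before Y Z" "blk P c Y" "blk P d Z"
proof -
  obtain Gs where G: "length Gs = c + d" "sorted_wrt before Gs" "\<forall>G\<in>set Gs. P G \<and> G \<subseteq> X"
    using assms unfolding blk_def by blast
  define Hs Ks where "Hs = take c Gs" and "Ks = drop c Gs"
  have Gs: "Gs = Hs @ Ks" by (simp add: Hs_def Ks_def)
  have len: "length Hs = c" "length Ks = d" using G(1) by (auto simp: Hs_def Ks_def)
  show ?thesis
  proof (rule that[of "\<Union>(set Hs)" "\<Union>(set Ks)"])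
    show "before (\<Union>(set Hs)) (\<Union>(set Ks))"
      using G(2) unfolding Gs sorted_wrt_append before_def by blast
    show "blk P c (\<Union>(set Hs))"
      using G len unfolding Gs sorted_wrt_append blk_def by (intro exI[of _ Hs]) auto
    show "blk P d (\<Union>(set Ks))"
      using G len unfolding Gs sorted_wrt_append blk_def by (intro exI[of _ Ks]) auto
  qed (use G Gs in auto)
qed

lemma blk_Un:
  assumes "before Y Z" "blk P c Y" "blk P d Z"
  shows "blk P (c + d) (Y \<union> Z)"
proof -
  obtain Gs where G: "length Gs = c" "sorted_wrt before Gs" "\<forall>G\<in>set Gs. P G \<and> G \<subseteq> Y"
    using assms(2) unfolding blk_def by blast
  obtain Hs where H: "length Hs = d" "sorted_wrt before Hs" "\<forall>G\<in>set Hs. P G \<and> G \<subseteq> Z"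
    using assms(3) unfolding blk_def by blast
  have "sorted_wrt before (Gs @ Hs)"
    unfolding sorted_wrt_append using G(2,3) H(2,3) before_mono[OF assms(1)] by simp
  moreover have "length (Gs @ Hs) = c + d" using G H by simp
  moreover have "\<forall>G\<in>set (Gs @ Hs). P G \<and> G \<subseteq> Y \<union> Z" using G H by auto
  ultimately show ?thesis unfolding blk_def by blast
qed

lemma blk_Suc:
  assumes "blk P (Suc c) X"
  obtains Y Z where "Y \<subseteq> X" "Z \<subseteq> X" "before Y Z" "P Y" "blk P c Z"
proof -
  obtain Y Z where *: "Y \<subseteq> X" "Z \<subseteq> X" "before Y Z" "blk P 1 Y" "blk P c Z"
    using blk_add[of P 1 c X] assms by auto
  then obtain G where "G \<subseteq> Y" "P G" by auto
  then show ?thesis using that[of G Z] * before_mono by blast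
qed

lemma blk_snoc:
  assumes "blk P (Suc c) X"
  obtains Y Z where "Y \<subseteq> X" "Z \<subseteq> X" "before Y Z" "blk P c Y" "P Z"
proof -
  obtain Y Z where *: "Y \<subseteq> X" "Z \<subseteq> X" "before Y Z" "blk P c Y" "blk P 1 Z"
    using blk_add[of P c 1 X] assms by auto
  then obtain G where "G \<subseteq> Z" "P G" by auto
  then show ?thesis using that[of Y G] * before_mono by blast
qed

lemma blk_ConsI:
  assumes "P Y" "blk P c Z" "before Y Z" "Y \<subseteq> X" "Z \<subseteq> X"
  shows "blk P (Suc c) X"
proof -
  have "blk P (1 + c) (Y \<union> Z)" using assms by (intro blk_Un) auto
  then show ?thesis using blk_mono[of P "1 + c" _ X "Suc c"] assms by auto
qed

lemma blk_mult:
  "blk P (c * d) X \<Longrightarrow> blk (blk P c) d X"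
proof (induction d arbitrary: X)
  case (Suc d)
  then obtain Y Z where *: "Y \<subseteq> X" "Z \<subseteq> X" "before Y Z" "blk P c Y" "blk P (c * d) Z"
    using blk_add[of P c "c * d" X] by auto
  then show ?case using Suc.IH blk_ConsI[of "blk P c" Y d Z X] by auto
qed simp

lemma length_filter_sum:
  assumes "finite T" "\<forall>x\<in>set xs. cl x \<in> T"
  shows "length xs = (\<Sum>c\<in>T. length (filter (\<lambda>x. cl x = c) xs))"
  using assms(2)
proof (induction xs)
  case (Cons x xs)
  have "(\<Sum>c\<in>T. length (filter (\<lambda>x. cl x = c) (x # xs))) =
      (\<Sum>c\<in>T. (if cl x = c then 1 else 0) + length (filter (\<lambda>x. cl x = c) xs))"
    by (intro sum.cong) auto
  also have "\<dots> = 1 + length xs"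
    using Cons assms(1) by (simp add: sum.distrib)
  finally show ?case by simp
qed simp

text \<open>Stacks of finite exponents, top first, are the ordinals below \<open>\<omega>\<^bsup>\<omega>\<^esup>\<close> read from the right.\<close>

fun stack_step :: "nat \<Rightarrow> nat list \<Rightarrow> nat list" where
  "stack_step x [] = []"
| "stack_step x (0 # s) = s"
| "stack_step x (Suc e # s) = replicate x e @ s"

section \<open>Block largeness versus largeness by fundamental sequences\<close>

definition stack_ord :: "nat list \<Rightarrow> ord_cnf" where
  "stack_ord s = CNF (map ord_of_nat (rev s))"

text \<open>Finite exponents are zero or successors, so the limit clause of \<open>fundseq\<close>
  never applies, and one step acts on the last term only, which is the top of the stack.\<close>

lemma fundseq_stack_ord: "fundseq (stack_ord s) x = stack_ord (stack_step x s)"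
proof (cases s)
  case (Cons e t)
  show ?thesis
  proof (cases e)
    case (Suc d)
    have "replicate (Suc d) ord_zero = replicate d ord_zero @ [ord_zero]"
      by (simp add: replicate_append_same)
    then have "last (exponents (ord_of_nat e)) = ord_zero"
        "butlast (exponents (ord_of_nat e)) = replicate d ord_zero"
      by (simp_all only: ord_of_nat_def Suc ord_cnf.sel last_snoc butlast_snoc)
    moreover have "ord_of_nat e \<noteq> ord_zero" by (simp add: ord_of_nat_def Suc)
    ultimately show ?thesis
      by (simp add: stack_ord_def Cons fundseq.simps Suc butlast_append)
        (simp add: ord_of_nat_def)
  qed (simp add: stack_ord_def Cons fundseq.simps ord_of_nat_def butlast_append)
qed (simp add: stack_ord_def fundseq.simps)

lemma fold_fundseq_stack_ord:
  "fold (\<lambda>x \<beta>. fundseq \<beta> x) xs (stack_ord s) = stack_ord (fold stack_step xs s)"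
  by (induction xs arbitrary: s) (simp_all add: fundseq_stack_ord)

lemma large_omega_pow_iff:
  "large (omega_pow (ord_of_nat m)) X \<longleftrightarrow>
     finite X \<and> fold stack_step (sorted_list_of_set X) [m] = []"
proof -
  have "omega_pow (ord_of_nat m) = stack_ord [m]"
    by (simp add: omega_pow_def stack_ord_def)
  then show ?thesis
    by (simp add: large_def fundseq_set_def fold_fundseq_stack_ord) (simp add: stack_ord_def)
qed

text \<open>An element \<open>x\<close> read while \<open>Suc e\<close> is on top becomes the head
  of that block. It pushes \<open>x\<close> copies of \<open>e\<close>, and the blocks that the rest
  of the run gives to these copies form its body.\<close>

lemma stack_run_blocks:
  assumes "fold stack_step xs s = []" "sorted_wrt (<) xs"
  shows "\<exists>Gs. list_all2 lrg s Gs \<and> sorted_wrt before Gs \<and> (\<forall>G\<in>set Gs. G \<subseteq> set xs)"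
  using assms
proof (induction xs arbitrary: s)
  case Nil
  then show ?case by (intro exI[of _ "[]"]) simp
next
  case (Cons x xs)
  obtain Gs where G: "list_all2 lrg (stack_step x s) Gs" "sorted_wrt before Gs"
      "\<forall>G\<in>set Gs. G \<subseteq> set xs"
    using Cons.IH[of "stack_step x s"] Cons.prems by auto
  have lt: "\<forall>y\<in>set xs. x < y" using Cons.prems(2) by simp
  show ?case
  proof (cases "(x, s)" rule: stack_step.cases)
    case (1 x')
    then show ?thesis by (intro exI[of _ "[]"]) simp
  next
    case (2 x' t)
    have "before {x} G" if "G \<in> set Gs" for G using that lt G(3) unfolding before_def by blast
    then show ?thesis using 2 G by (intro exI[of _ "{x} # Gs"]) auto
  next
    case (3 x' e t)
    then have s: "s = Suc e # t" by simp
    \<comment> \<open>\<open>Hs\<close> belongs to the copies pushed by \<open>x\<close>,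
      \<open>Ks\<close> to the entries below them.\<close>
    obtain Hs Ks where GHK: "Gs = Hs @ Ks" "list_all2 lrg (replicate x e) Hs" "list_all2 lrg t Ks"
      using G(1) unfolding s by (auto simp: list_all2_append1)
    define H where "H = insert x (\<Union>(set Hs))"
    have H1: "length Hs = x" using GHK(2) by (auto dest: list_all2_lengthD)
    have H2: "\<forall>G\<in>set Hs. lrg e G"
      using GHK(2) by (auto simp: list_all2_conv_all_nth in_set_conv_nth)
    have "blk (lrg e) x {y \<in> H. x < y}"
      unfolding blk_def using H1 H2 G(2,3) lt unfolding GHK(1) sorted_wrt_append
      by (intro exI[of _ Hs]) (auto simp: H_def)
    then have "lrg (Suc e) H" by (auto simp: H_def)
    moreover have "before H K" if "K \<in> set Ks" for K
      using G(2,3) lt that unfolding GHK(1) sorted_wrt_append H_def before_def by auto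
    ultimately show ?thesis using GHK G s
      by (intro exI[of _ "H # Ks"]) (auto simp: sorted_wrt_append H_def)
  qed
qed

lemma large_imp_lrg:
  assumes "large (omega_pow (ord_of_nat m)) X"
  shows "lrg m X"
proof -
  have "finite X" "fold stack_step (sorted_list_of_set X) [m] = []"
    using assms by (auto simp: large_omega_pow_iff)
  then obtain Gs where "list_all2 lrg [m] Gs" "\<forall>G\<in>set Gs. G \<subseteq> X"
    using stack_run_blocks[of "sorted_list_of_set X" "[m]"] by auto
  then show ?thesis using lrg_mono by (auto simp: list_all2_Cons1)
qed

text \<open>The chosen elements consume exactly the top entry, whatever \<open>t\<close> lies below
  it. This uniformity in \<open>t\<close> allows the runs of successive blocks to be
  concatenated.\<close>

lemma lrg_stack_run:
  "lrg e X \<Longrightarrow> \<exists>hs. set hs \<subseteq> X \<and> sorted_wrt (<) hs \<and> (\<forall>t. fold stack_step hs (e # t) = t)"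
proof (induction e arbitrary: X)
  case 0
  then obtain x where "x \<in> X" by auto
  then show ?case by (intro exI[of _ "[x]"]) simp
next
  case (Suc e)
  have *: "\<exists>hs. set hs \<subseteq> Y \<and> sorted_wrt (<) hs \<and>
      (\<forall>t. fold stack_step hs (replicate c e @ t) = t)" if "blk (lrg e) c Y" for c Y
    using that
  proof (induction c arbitrary: Y)
    case 0
    then show ?case by (intro exI[of _ "[]"]) simp
  next
    case (Suc c)
    obtain A B where AB: "A \<subseteq> Y" "B \<subseteq> Y" "before A B" "lrg e A" "blk (lrg e) c B"
      using blk_Suc Suc.prems by blast
    obtain as where "set as \<subseteq> A" "sorted_wrt (<) as" "\<forall>t. fold stack_step as (e # t) = t"
      using \<open>\<And>X. lrg e X \<Longrightarrow> _\<close>[OF AB(4)] by blast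
    moreover obtain bs where "set bs \<subseteq> B" "sorted_wrt (<) bs"
        "\<forall>t. fold stack_step bs (replicate c e @ t) = t"
      using Suc.IH[OF AB(5)] by blast
    moreover from calculation have "\<forall>a\<in>set as. \<forall>b\<in>set bs. a < b"
      using AB(3) unfolding before_def by blast
    ultimately show ?case using AB
      by (intro exI[of _ "as @ bs"]) (auto simp: sorted_wrt_append)
  qed
  obtain x where x: "x \<in> X" "blk (lrg e) x {y \<in> X. x < y}" using Suc.prems by auto
  then obtain hs where "set hs \<subseteq> {y \<in> X. x < y}" "sorted_wrt (<) hs"
      "\<forall>t. fold stack_step hs (replicate x e @ t) = t"
    using * by blast
  then show ?case using x by (intro exI[of _ "x # hs"]) auto
qed

lemma lrg_imp_large:
  assumes "lrg m X"
  shows "\<exists>H\<subseteq>X. large (omega_pow (ord_of_nat m)) H"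
proof -
  obtain hs where hs: "set hs \<subseteq> X" "sorted_wrt (<) hs" "fold stack_step hs [m] = []"
    using lrg_stack_run[OF assms] by blast
  have "sorted_list_of_set (set hs) = hs"
    using hs(2) by (simp add: sorted_list_of_set.idem_if_sorted_distinct strict_sorted_iff)
  then show ?thesis using hs by (intro exI[of _ "set hs"]) (simp add: large_omega_pow_iff)
qed

subsection \<open>Growth and sparse subsets\<close>

text \<open>Two exponentials come from bounds \<open>(k + 1) ^ (2 * N)\<close> in which
  \<open>N\<close> is itself a Ramsey number; the third absorbs the polynomial in the exponent of
  \<open>N\<close>.\<close>

definition hyp :: "nat \<Rightarrow> nat" where
  "hyp x = 2 ^ 2 ^ 2 ^ x"

definition sparse :: "nat set \<Rightarrow> bool" where
  "sparse X \<longleftrightarrow> (\<forall>x\<in>X. \<forall>y\<in>X. x < y \<longrightarrow> hyp x \<le> y)"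

lemma sparse_subset: "sparse X \<Longrightarrow> Y \<subseteq> X \<Longrightarrow> sparse Y"
  unfolding sparse_def by blast

section \<open>Numerical estimates for elements that are at least 17\<close>

lemma cube_le_power:
  assumes "17 \<le> y"
  shows "6 * y ^ 3 \<le> (2::nat) ^ y"
  using assms
proof (induction y rule: dec_induct)
  case (step y)
  \<comment> \<open>For \<open>y \<ge> 17\<close> the added part is at most \<open>y ^ 3\<close>, so
    a step at most doubles the cube, while it doubles the power. The factor 6 serves
    \<open>hyp_bounds_copies\<close>, where three factors \<open>2 ^ (2 * y ^ 3)\<close> are
    multiplied.\<close>
  have "(y + 1) ^ 3 = y ^ 3 + (3 * y\<^sup>2 + 3 * y + 1)"
    by (simp add: power3_eq_cube power2_eq_square algebra_simps)
  also have "3 * y\<^sup>2 + 3 * y + 1 \<le> 17 * y\<^sup>2"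
  proof -
    have "3 * y \<le> 3 * y\<^sup>2" "1 \<le> y\<^sup>2" using step by (auto simp: power2_eq_square)
    then show ?thesis by linarith
  qed
  also have "\<dots> \<le> y ^ 3" using step by (simp add: power3_eq_cube power2_eq_square)
  finally show ?case using step by simp
qed simp

lemma square_le_hyp:
  assumes "17 \<le> x"
  shows "x * x \<le> hyp x"
proof -
  have "x * x * 1 \<le> x * x * (6 * x)" using assms by (intro mult_le_mono) auto
  then have "x * x \<le> 6 * x ^ 3" by (simp add: power3_eq_cube algebra_simps)
  also have "\<dots> \<le> 2 ^ x" using assms by (rule cube_le_power)
  also have "\<dots> \<le> hyp x"
    unfolding hyp_def by (intro power_increasing) (auto intro: less_imp_le order.trans[OF less_imp_le[OF less_exp]])
  finally show ?thesis .
qed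

lemma Suc_power_le_two_power: "(k + 1) ^ a \<le> (2::nat) ^ (k * a)"
proof -
  have "k + 1 \<le> (2::nat) ^ k" using less_exp[of k] by (metis Suc_eq_plus1 Suc_leI)
  then have "(k + 1) ^ a \<le> (2 ^ k) ^ a" by (rule power_mono) simp
  then show ?thesis by (simp add: power_mult)
qed

text \<open>The left side is the number that \<open>ram_power\<close> provides for homogeneous sets
  of size \<open>2 * y\<close>.\<close>

lemma ramsey_bound_le:
  assumes "k \<le> y" "17 \<le> y"
  shows "(k + 1) ^ (k * (2 * y)) \<le> (2::nat) ^ (2 * y ^ 3)"
proof -
  have "k * (k * (2 * y)) \<le> y * (y * (2 * y))" using assms by (intro mult_le_mono) auto
  then have "(2::nat) ^ (k * (k * (2 * y))) \<le> 2 ^ (2 * y ^ 3)"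
    by (intro power_increasing) (auto simp: power3_eq_cube algebra_simps)
  then show ?thesis using Suc_power_le_two_power[of k "k * (2 * y)"] by linarith
qed

text \<open>Elements beyond \<open>hyp y\<close> thus satisfy the size hypothesis of
  \<open>homogeneous_blk\<close> when \<open>N\<close> is the Ramsey number for
  \<open>2 * y\<close>.\<close>

lemma hyp_bounds_min:
  assumes "k \<le> y" "17 \<le> y"
  shows "(k + 1) ^ (2 * (k + 1) ^ (k * (2 * y))) \<le> hyp y"
proof -
  define a where "a = (k + 1) ^ (k * (2 * y))"
  have "y + 2 * y ^ 3 \<le> 6 * y ^ 3"
    using assms by (simp add: power3_eq_cube)
  also have "\<dots> \<le> 2 ^ y" using assms cube_le_power by blast
  finally have *: "y + 2 * y ^ 3 \<le> 2 ^ y" .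
  have "2 * y \<le> 2 ^ y"
  proof -
    have "y * 1 \<le> y * (y * y)" using assms by (intro mult_le_mono) auto
    then have "y \<le> y ^ 3" by (simp add: power3_eq_cube)
    then show ?thesis using cube_le_power[OF assms(2)] by linarith
  qed
  then have "k * (2 * a) \<le> 2 ^ y * 2 ^ (2 * y ^ 3)"
    using mult_le_mono[of "2 * k" "2 ^ y" a "2 ^ (2 * y ^ 3)"] assms ramsey_bound_le[OF assms]
    by (simp add: a_def algebra_simps)
  also have "\<dots> = 2 ^ (y + 2 * y ^ 3)" by (simp add: power_add)
  also have "\<dots> \<le> 2 ^ 2 ^ y" using * by (intro power_increasing) auto
  finally have "(2::nat) ^ (k * (2 * a)) \<le> hyp y"
    unfolding hyp_def by (intro power_increasing) auto
  then show ?thesis using Suc_power_le_two_power[of k "2 * a"] by (simp add: a_def)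
qed

text \<open>The factors bound, in this order, the cost of sorting by the colours from earlier
  points, the cost of sorting by the colours towards later blocks, and the number of copies that
  must survive both thinnings in \<open>cross_homogeneous_blocks\<close>.\<close>

lemma hyp_bounds_copies:
  assumes "1 \<le> k" "k \<le> y" "17 \<le> y"
  shows "(k + 1) ^ (2 * y) * (y * (k + 1) ^ (k * (2 * y))) \<le> hyp y"
proof -
  let ?a = "(2::nat) ^ (2 * y ^ 3)"
  have "(k + 1) ^ (2 * y) \<le> (k + 1) ^ (k * (2 * y))"
    using assms by (intro power_increasing) auto
  also have "\<dots> \<le> ?a" using ramsey_bound_le assms by blast
  finally have 1: "(k + 1) ^ (2 * y) \<le> ?a" .
  have "y \<le> 2 * y ^ 3" using assms by (simp add: power3_eq_cube)
  then have "y \<le> ?a" using less_exp[of "2 * y ^ 3"] by linarith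
  then have "(k + 1) ^ (2 * y) * (y * (k + 1) ^ (k * (2 * y))) \<le> ?a * (?a * ?a)"
    using 1 ramsey_bound_le[OF assms(2,3)] by (intro mult_le_mono) auto
  also have "\<dots> = 2 ^ (6 * y ^ 3)" by (simp add: power_add[symmetric])
  also have "\<dots> \<le> hyp y"
    unfolding hyp_def using cube_le_power[OF assms(3)] less_exp[of "2 ^ y"]
    by (intro power_increasing) (auto intro: order.trans less_imp_le)
  finally show ?thesis .
qed

section \<open>Growth forced by largeness\<close>

lemma lrg_growth_exponent:
  "lrg e D \<Longrightarrow> \<forall>d\<in>D. y < d \<Longrightarrow> \<exists>d\<in>D. y + e < d"
proof (induction e arbitrary: D y)
  case 0
  then show ?case by auto
next
  case (Suc e)
  obtain x where x: "x \<in> D" "blk (lrg e) x {y \<in> D. x < y}" using Suc.prems by auto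
  \<comment> \<open>The head \<open>x\<close> exceeds \<open>y\<close>, hence is positive, and at
    least one subblock follows it. So each level of the exponent raises the bound by one.\<close>
  then have "blk (lrg e) (Suc 0) {y \<in> D. x < y}"
    using Suc.prems(2) by (intro blk_mono[OF x(2)]) auto
  then obtain G where G: "G \<subseteq> {y \<in> D. x < y}" "lrg e G" by auto
  then obtain d where "d \<in> G" "x + e < d" using Suc.IH[of G x] by auto
  then show ?case using G Suc.prems(2) x by (intro bexI[of _ d]) auto
qed

lemma blk_growth_linear:
  assumes "blk (lrg e) c D" "\<forall>d\<in>D. y < d"
  shows "\<exists>d\<in>insert y D. y + c \<le> d"
  using assms
proof (induction c arbitrary: D)
  case (Suc c)
  obtain Y Z where *: "Y \<subseteq> D" "Z \<subseteq> D" "before Y Z" "blk (lrg e) c Y" "lrg e Z"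
    using blk_snoc Suc.prems(1) by blast
  obtain d where d: "d \<in> insert y Y" "y + c \<le> d"
    using Suc.IH[OF *(4)] Suc.prems(2) *(1) by blast
  obtain z where "z \<in> Z" using lrg_nonempty[OF *(5)] by blast
  moreover have "d < z" using d calculation *(2,3) Suc.prems(2) unfolding before_def by auto
  ultimately show ?case using *(2) d(2) by (intro bexI[of _ z]) auto
qed simp

text \<open>A block of positive exponent doubles the bound: its head \<open>z\<close> is followed by
  \<open>z\<close> subblocks, which reach \<open>z + z\<close>. Inserting \<open>y\<close> covers
  \<open>c = 0\<close>.\<close>

lemma blk_growth_exp:
  assumes "blk (lrg (Suc e)) c D" "\<forall>d\<in>D. y < d"
  shows "\<exists>d\<in>insert y D. 2 ^ c * y \<le> d"
  using assms
proof (induction c arbitrary: D)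
  case (Suc c)
  obtain Y Z where *: "Y \<subseteq> D" "Z \<subseteq> D" "before Y Z" "blk (lrg (Suc e)) c Y" "lrg (Suc e) Z"
    using blk_snoc Suc.prems(1) by blast
  obtain d where d: "d \<in> insert y Y" "2 ^ c * y \<le> d"
    using Suc.IH[OF *(4)] Suc.prems(2) *(1) by blast
  obtain z where z: "z \<in> Z" "blk (lrg e) z {y \<in> Z. z < y}" using *(5) by auto
  have "d < z" using d z *(2,3) Suc.prems(2) unfolding before_def by auto
  obtain w where "w \<in> insert z {y \<in> Z. z < y}" "z + z \<le> w"
    using blk_growth_linear[OF z(2), of z] by auto
  then show ?case using *(2) d(2) \<open>d < z\<close> z by (intro bexI[of _ w]) auto
qed simp

text \<open>The head \<open>x > y\<close> is followed by \<open>x\<close> doublings.\<close>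

lemma lrg_growth_exp:
  assumes "lrg (Suc (Suc e)) D" "\<forall>d\<in>D. y < d"
  shows "\<exists>d\<in>D. 2 ^ y \<le> d"
proof -
  obtain x where x: "x \<in> D" "blk (lrg (Suc e)) x {y \<in> D. x < y}" using assms by auto
  then obtain d where d: "d \<in> insert x {y \<in> D. x < y}" "2 ^ x * x \<le> d"
    using blk_growth_exp[OF x(2), of x] by blast
  have "y < x" using assms(2) x(1) by blast
  then have "(2::nat) ^ y * 1 \<le> 2 ^ x * x" by (intro mult_le_mono power_increasing) auto
  then have "2 ^ y \<le> d" using d(2) by linarith
  then show ?thesis using d(1) x(1) by blast
qed

text \<open>Each of the three blocks contributes one exponential.\<close>

lemma blk_growth_hyp:
  assumes "blk (lrg (Suc (Suc e))) 3 D" "\<forall>d\<in>D. y < d"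
  shows "\<exists>d\<in>D. hyp y \<le> d"
proof -
  have "blk (lrg (Suc (Suc e))) (Suc (Suc (Suc 0))) D" using assms(1) by (simp add: numeral_3_eq_3)
  then obtain A B where A: "A \<subseteq> D" "B \<subseteq> D" "before A B" "lrg (Suc (Suc e)) A"
      "blk (lrg (Suc (Suc e))) (Suc (Suc 0)) B"
    by (rule blk_Suc)
  obtain C E where C: "C \<subseteq> B" "E \<subseteq> B" "before C E" "lrg (Suc (Suc e)) C"
      "blk (lrg (Suc (Suc e))) (Suc 0) E"
    using A(5) by (rule blk_Suc)
  obtain G where G: "G \<subseteq> E" "lrg (Suc (Suc e)) G" using C(5) by auto
  obtain a where a: "a \<in> A" "2 ^ y \<le> a" using lrg_growth_exp[OF A(4)] A(1) assms(2) by blast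
  obtain b where b: "b \<in> C" "2 ^ a \<le> b"
    using lrg_growth_exp[OF C(4), of a] a A(3) C(1) unfolding before_def by blast
  obtain d where d: "d \<in> G" "2 ^ b \<le> d"
    using lrg_growth_exp[OF G(2), of b] b C(3) G(1) unfolding before_def by blast
  have "(2::nat) ^ 2 ^ y \<le> 2 ^ a" using a(2) by (intro power_increasing) auto
  then have "2 ^ 2 ^ y \<le> b" using b(2) by linarith
  then have "hyp y \<le> 2 ^ b" unfolding hyp_def by (intro power_increasing) auto
  then show ?thesis using d G(1) C(2) A(2) by (intro bexI[of _ d]) auto
qed

text \<open>Three blocks between \<open>A\<close> and \<open>B\<close> act as a spacer, so that
  sparse \<open>A\<close> and \<open>B\<close> have a sparse union.\<close>

lemma hyp_gap:
  assumes "blk (lrg (Suc (Suc e))) 3 D" "before A D" "before D B" "a \<in> A" "b \<in> B"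
  shows "hyp a \<le> b"
proof -
  obtain d where "d \<in> D" "hyp a \<le> d"
    using blk_growth_hyp[OF assms(1), of a] assms(2,4) unfolding before_def by blast
  then show ?thesis using assms(3,5) unfolding before_def by fastforce
qed

section \<open>Extraction of sparse subsets\<close>

lemma sparse_Un:
  assumes "sparse A" "sparse B" "before A B" "\<And>a b. a \<in> A \<Longrightarrow> b \<in> B \<Longrightarrow> hyp a \<le> b"
  shows "sparse (A \<union> B)"
  using assms unfolding sparse_def before_def by (metis UnE less_asym)

text \<open>The head is taken from the first block, the body from the second, whose own head is so
  big that it provides five subblocks for each unit of the first head. Of every five, three form a
  spacer and two feed the induction hypothesis.\<close>

lemma sparse_lrg_subset:
  assumes "blk (lrg (Suc (Suc m))) 2 X" "\<forall>x\<in>X. 17 \<le> x"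
  shows "\<exists>Y\<subseteq>X. sparse Y \<and> lrg m Y"
  using assms
proof (induction m arbitrary: X)
  case 0
  have "blk (lrg (Suc (Suc 0))) (Suc 0) X" by (rule blk_mono[OF 0(1)]) auto
  then obtain G where "G \<subseteq> X" "lrg (Suc (Suc 0)) G" unfolding blk_1 by blast
  then obtain x where "x \<in> X" using lrg_nonempty by blast
  then show ?case by (intro exI[of _ "{x}"]) (simp add: sparse_def)
next
  case (Suc m)
  note IH = Suc.IH
  let ?L = "lrg (Suc (Suc m))"
  \<comment> \<open>The groups of five are appended one after another; \<open>v\<close> stays in the
    sparse set because it will be the head.\<close>
  have blocks: "\<exists>Y\<subseteq>Z. sparse (insert v Y) \<and> blk (lrg m) c Y"
    if "blk (blk ?L 5) c Z" "Z \<subseteq> X" "\<forall>z\<in>Z. v < z" for c Z v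
    using that
  proof (induction c arbitrary: Z)
    case 0
    then show ?case by (intro exI[of _ "{}"]) (simp add: sparse_def)
  next
    case (Suc c)
    obtain A B where AB: "A \<subseteq> Z" "B \<subseteq> Z" "before A B" "blk (blk ?L 5) c A" "blk ?L 5 B"
      using Suc.prems(1) by (rule blk_snoc)
    have "blk ?L (3 + 2) B" using AB(5) by simp
    then obtain D E where DE: "D \<subseteq> B" "E \<subseteq> B" "before D E" "blk ?L 3 D" "blk ?L 2 E"
      by (rule blk_add)
    have "\<forall>x\<in>E. 17 \<le> x" using DE(2) AB(2) Suc.prems(2) \<open>\<forall>x\<in>X. 17 \<le> x\<close> by blast
    then obtain E' where E: "E' \<subseteq> E" "sparse E'" "lrg m E'"
      using IH[OF DE(5)] by blast
    obtain Y where Y: "Y \<subseteq> A" "sparse (insert v Y)" "blk (lrg m) c Y"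
      using Suc.IH[OF AB(4)] AB(1) Suc.prems by blast
    have Bv: "before {v} B" using AB(2) Suc.prems(3) unfolding before_def by blast
    have "before (insert v Y) D" "before D E'" "before (insert v Y) E'"
      using DE E Y AB(3) Bv unfolding before_def by blast+
    moreover from this have "sparse (insert v Y \<union> E')"
      using sparse_Un[OF Y(2) E(2)] hyp_gap[OF DE(4), of "insert v Y" E'] by blast
    moreover have "blk (lrg m) (c + 1) (Y \<union> E')"
      using Y(3) E(3) calculation by (intro blk_Un) (auto simp: before_def)
    ultimately show ?case using Y(1) E(1) AB(1,2) DE(2)
      by (intro exI[of _ "Y \<union> E'"]) auto
  qed
  have "blk (lrg (Suc (Suc (Suc m)))) (Suc (Suc 0)) X"
    using Suc.prems(1) by (simp only: numeral_2_eq_2)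
  then obtain A B where AB: "A \<subseteq> X" "B \<subseteq> X" "before A B" "lrg (Suc (Suc (Suc m))) A"
      "blk (lrg (Suc (Suc (Suc m)))) (Suc 0) B"
    by (rule blk_Suc)
  obtain B' where B': "B' \<subseteq> B" "lrg (Suc (Suc (Suc m))) B'" using AB(5) unfolding blk_1 by blast
  obtain v where v: "v \<in> A" "blk ?L v {y \<in> A. v < y}" using AB(4) by auto
  obtain w where w: "w \<in> B'" "blk ?L w {y \<in> B'. w < y}" using B'(2) by auto
  have "17 \<le> v" using v(1) AB(1) Suc.prems(2) by blast
  have "v < w" using v(1) w(1) B'(1) AB(3) unfolding before_def by blast
  have "blk ?L 1 {y \<in> A. v < y}" using \<open>17 \<le> v\<close> by (intro blk_mono[OF v(2)]) auto
  then obtain G where G: "G \<subseteq> {y \<in> A. v < y}" "?L G" unfolding One_nat_def blk_1 by blast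
  then obtain d where d: "d \<in> G" "2 ^ v \<le> d" using lrg_growth_exp[OF G(2), of v] by blast
  have "d < w" using d(1) G(1) w(1) B'(1) AB(3) unfolding before_def by blast
  \<comment> \<open>The rest of the first block already reaches \<open>2 ^ v\<close>, so the head
    \<open>w\<close> of the second block is at least \<open>5 * v\<close>.\<close>
  have "5 * v * 1 \<le> 6 * v * (v * v)" using \<open>17 \<le> v\<close> by (intro mult_le_mono) auto
  then have "5 * v \<le> 6 * v ^ 3" by (simp add: power3_eq_cube)
  also have "\<dots> \<le> 2 ^ v" using \<open>17 \<le> v\<close> by (rule cube_le_power)
  finally have "5 * v \<le> w" using d(2) \<open>d < w\<close> by linarith
  then have "blk ?L (5 * v) {y \<in> B'. w < y}" by (intro blk_mono[OF w(2)]) auto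
  then have "blk (blk ?L 5) v {y \<in> B'. w < y}" by (rule blk_mult)
  moreover have "{y \<in> B'. w < y} \<subseteq> X" using B'(1) AB(2) by blast
  ultimately obtain Y where Y: "Y \<subseteq> {y \<in> B'. w < y}" "sparse (insert v Y)" "blk (lrg m) v Y"
    using blocks[of v "{y \<in> B'. w < y}" v] \<open>v < w\<close> by auto
  have "blk (lrg m) v {y \<in> insert v Y. v < y}"
    using Y(1) \<open>v < w\<close> by (intro blk_mono[OF Y(3)]) auto
  then have "lrg (Suc m) (insert v Y)" by auto
  then show ?case using Y(1,2) v(1) AB(1,2) B'(1) by (intro exI[of _ "insert v Y"]) auto
qed

subsection \<open>Partitions and finite Ramsey numbers\<close>

text \<open>Each of \<open>D * M\<close> groups of \<open>D\<close> blocks has a class that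
  satisfies \<open>P\<close> within the group. As \<open>card T \<le> D\<close>, some class is
  chosen by at least \<open>M\<close> groups.\<close>

lemma blk_pigeonhole:
  assumes "finite T" "T \<noteq> {}" "card T \<le> D"
    and "\<And>Y. Y \<subseteq> X \<Longrightarrow> blk P D Y \<Longrightarrow> \<exists>c\<in>T. P {x \<in> Y. t x = c}"
    and "blk P (D * D * M) X"
  shows "\<exists>c\<in>T. blk P M {x \<in> X. t x = c}"
\<comment> \<open>The count below uses the truncated \<open>M - 1\<close>, so \<open>M = 0\<close>
  is treated apart.\<close>
proof (cases "M = 0")
  case True
  then show ?thesis using assms(2) by auto
next
  case False
  have "blk (blk P D) (D * M) X" using assms(5) by (intro blk_mult) (simp add: mult.assoc)
  then obtain Ys where Ys: "length Ys = D * M" "sorted_wrt before Ys"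
      "\<forall>Y\<in>set Ys. blk P D Y \<and> Y \<subseteq> X"
    unfolding blk_def[of "blk P D"] by blast
  then have "\<forall>Y\<in>set Ys. \<exists>c. c \<in> T \<and> P {x \<in> Y. t x = c}" using assms(4) by blast
  then obtain cl where cl: "\<forall>Y\<in>set Ys. cl Y \<in> T \<and> P {x \<in> Y. t x = cl Y}" by metis
  have "\<exists>c\<in>T. M \<le> length (filter (\<lambda>Y. cl Y = c) Ys)"
  proof (rule ccontr)
    assume "\<not> ?thesis"
    then have "length (filter (\<lambda>Y. cl Y = c) Ys) \<le> M - 1" if "c \<in> T" for c
      using that by fastforce
    then have "(\<Sum>c\<in>T. length (filter (\<lambda>Y. cl Y = c) Ys)) \<le> card T * (M - 1)"
      using sum_bounded_above[of T "\<lambda>c. length (filter (\<lambda>Y. cl Y = c) Ys)" "M - 1"] by simp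
    then have "D * M \<le> card T * (M - 1)"
      using length_filter_sum[OF assms(1), of Ys cl] cl Ys(1) by simp
    also have "\<dots> \<le> D * (M - 1)" using assms(3) by simp
    finally have "D * M \<le> D * (M - 1)" .
    moreover have "0 < D" using assms(1-3) by (metis card_gt_0_iff gr0I le_zero_eq not_gr_zero)
    ultimately show False using False by simp
  qed
  then obtain c where c: "c \<in> T" "M \<le> length (filter (\<lambda>Y. cl Y = c) Ys)" by blast
  define Zs where "Zs = map (\<lambda>Y. {x \<in> Y. t x = c}) (filter (\<lambda>Y. cl Y = c) Ys)"
  have "sorted_wrt before Zs"
    unfolding Zs_def sorted_wrt_map
    by (rule sorted_wrt_mono_rel[OF _ sorted_wrt_filter[OF Ys(2)]]) (auto simp: before_def)
  moreover have "P Z \<and> Z \<subseteq> {x \<in> X. t x = c}" if "Z \<in> set Zs" for Z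
    using that cl Ys(3) by (auto simp: Zs_def)
  ultimately have "blk P (length Zs) {x \<in> X. t x = c}" unfolding blk_def by blast
  then have "blk P M {x \<in> X. t x = c}" by (rule blk_mono) (use c in \<open>auto simp: Zs_def\<close>)
  then show ?thesis using c(1) by blast
qed

text \<open>
  If every class has an element in the first \<open>card T - 1\<close> blocks, then sparseness makes the head of
  the last block so big that some class gets enough subblocks to follow its own early element;
  otherwise one class is missing from these blocks.
\<close>

lemma partition_lrg:
  assumes "sparse X" "\<forall>x\<in>X. 17 \<le> x \<and> D * D \<le> x"
    and "finite T" "T \<noteq> {}" "card T \<le> D" "t ` X \<subseteq> T" "blk (lrg e) (card T) X"
  shows "\<exists>c\<in>T. lrg e {x \<in> X. t x = c}"
  using assms
proof (induction e arbitrary: X T)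
  case 0
  have "blk (lrg 0) (Suc 0) X"
    using 0(3,4) by (intro blk_mono[OF 0(7)]) (auto simp: Suc_le_eq card_gt_0_iff)
  then obtain x where "x \<in> X" by auto
  then show ?case using 0(6) by auto
next
  case (Suc e)
  note IH = Suc.IH
  show ?case using Suc.prems
  proof (induction "card T" arbitrary: X T)
    case 0
    then show ?case by simp
  next
    case (Suc d)
    note prems = Suc.prems
    have "blk (lrg (Suc e)) (Suc d) X" using prems(7) Suc.hyps(2) by simp
    then obtain Y W where YW: "Y \<subseteq> X" "W \<subseteq> X" "before Y W" "blk (lrg (Suc e)) d Y" "lrg (Suc e) W"
      by (rule blk_snoc)
    show ?case
    proof (cases "T \<subseteq> t ` Y")
      case False
      then obtain c where c: "c \<in> T" "c \<notin> t ` Y" by blast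
      show ?thesis
      \<comment> \<open>If \<open>c\<close> is the only class, then \<open>d = 0\<close> and
        \<open>Y\<close> may be empty; the last block \<open>W\<close> is then the witness.\<close>
      proof (cases "T = {c}")
        case True
        then have "{x \<in> X. t x = c} = X" using prems(6) by auto
        then show ?thesis using True lrg_mono[OF YW(5,2)] by simp
      next
        case ne: False
        \<comment> \<open>On \<open>Y\<close> the class \<open>c\<close> does not occur, so the
          \<open>d\<close> blocks there match the \<open>d\<close> remaining classes.\<close>
        have "d = card (T - {c})" using Suc.hyps(2) c(1) prems(3) by simp
        moreover from this have "\<exists>c'\<in>T - {c}. lrg (Suc e) {x \<in> Y. t x = c'}"
          using Suc.hyps(2) prems YW(1,4) c ne
          by (intro Suc.hyps(1)) (auto intro: sparse_subset)
        ultimately obtain c' where "c' \<in> T" "lrg (Suc e) {x \<in> Y. t x = c'}" by blast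
        moreover have "{x \<in> Y. t x = c'} \<subseteq> {x \<in> X. t x = c'}" using YW(1) by blast
        ultimately show ?thesis using lrg_mono by blast
      qed
    next
      case True
      obtain w where w: "w \<in> W" "blk (lrg e) w {y \<in> W. w < y}" using YW(5) by auto
      \<comment> \<open>The number of subblocks of a single class that the pigeonhole leaves behind
        \<open>w\<close>.\<close>
      define M where "M = w div (D * D)"
      have "D * D * M \<le> w" by (simp add: M_def)
      then have "blk (lrg e) (D * D * M) {y \<in> W. w < y}" by (intro blk_mono[OF w(2)]) auto
      moreover have "\<exists>c\<in>T. lrg e {x \<in> Z. t x = c}"
        if "Z \<subseteq> {y \<in> W. w < y}" "blk (lrg e) D Z" for Z
      proof (rule IH)
        have "Z \<subseteq> X" using that(1) YW(2) by blast
        then show "sparse Z" "\<forall>x\<in>Z. 17 \<le> x \<and> D * D \<le> x" "t ` Z \<subseteq> T"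
          using prems sparse_subset by blast+
        show "blk (lrg e) (card T) Z" using prems(5) by (intro blk_mono[OF that(2)]) auto
      qed (use prems in auto)
      ultimately obtain c where c: "c \<in> T" "blk (lrg e) M {x \<in> {y \<in> W. w < y}. t x = c}"
        using blk_pigeonhole[OF prems(3,4,5), of "{y \<in> W. w < y}" "lrg e" t M] by blast
      obtain y where y: "y \<in> Y" "t y = c" using True c(1) by blast
      have "y < w" using y(1) w(1) YW(3) unfolding before_def by blast
      then have "hyp y \<le> w" using prems(1) y(1) w(1) YW(1,2) unfolding sparse_def by blast
      moreover have "17 \<le> y" "D * D \<le> y" using prems(2) y(1) YW(1) by blast+
      \<comment> \<open>Here \<open>D * D * y \<le> y * y \<le> hyp y \<le> w\<close>: the gap
        between \<open>y\<close> and \<open>w\<close> pays for the pigeonhole and leaves the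
        \<open>y\<close> subblocks that the head \<open>y\<close> requires.\<close>
      ultimately have "D * D * y \<le> w" using square_le_hyp[of y] mult_le_mono1[of "D * D" y y] by linarith
      moreover have "0 < D" using prems(3-5) by (metis card_gt_0_iff gr0I le_zero_eq not_gr_zero)
      ultimately have "y \<le> M" by (simp add: M_def less_eq_div_iff_mult_less_eq mult.commute)
      have "blk (lrg e) y {z \<in> {x \<in> X. t x = c}. y < z}"
        using YW(2) \<open>y < w\<close> \<open>y \<le> M\<close> by (intro blk_mono[OF c(2)]) auto
      moreover have "y \<in> {x \<in> X. t x = c}" using y YW(1) by auto
      ultimately have "lrg (Suc e) {x \<in> X. t x = c}" unfolding lrg.simps by blast
      then show ?thesis using c(1) by blast
    qed
  qed
qed

text \<open>Sorting into at most \<open>D\<close> classes costs a factor \<open>D * D\<close> in the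
  number of blocks.\<close>

lemma partition_blk:
  assumes "sparse X" "\<forall>x\<in>X. 17 \<le> x \<and> D * D \<le> x"
    and "finite T" "T \<noteq> {}" "card T \<le> D" "t ` X \<subseteq> T" "blk (lrg e) (D * D * M) X"
  obtains c where "c \<in> T" "blk (lrg e) M {x \<in> X. t x = c}"
proof -
  have "\<exists>c\<in>T. lrg e {x \<in> Y. t x = c}" if "Y \<subseteq> X" "blk (lrg e) D Y" for Y
  proof (rule partition_lrg[where D = D])
    show "blk (lrg e) (card T) Y" using assms(5) by (intro blk_mono[OF that(2)]) auto
  qed (use that assms sparse_subset in auto)
  then show ?thesis
    using blk_pigeonhole[OF assms(3-5), of X "lrg e" t M] assms(7) that by blast
qed

text \<open>The arrow relation N -> (r)^2_k, with colours read on increasing pairs only.\<close>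

definition ram :: "nat \<Rightarrow> nat \<Rightarrow> nat \<Rightarrow> bool" where
  "ram k N r \<longleftrightarrow> (\<forall>g. (\<forall>i j. i < j \<longrightarrow> j < N \<longrightarrow> g i j < k) \<longrightarrow>
     (\<exists>c<k. \<exists>I\<subseteq>{..<N}. card I = r \<and> (\<forall>i\<in>I. \<forall>j\<in>I. i < j \<longrightarrow> g i j = c)))"

text \<open>The least vertex \<open>v\<close> has one colour \<open>c\<close> towards many others.
  Among these the target for \<open>c\<close> is lowered by one, and \<open>v\<close> restores it if
  colour \<open>c\<close> is obtained there. Separate targets for the colours make this an induction
  on their sum.\<close>

lemma ramsey_asymmetric:
  fixes g :: "nat \<Rightarrow> nat \<Rightarrow> nat" and q :: "nat \<Rightarrow> nat"
  assumes "1 \<le> k" "finite V" "\<forall>i\<in>V. \<forall>j\<in>V. i < j \<longrightarrow> g i j < k"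
    and "(k + 1) ^ (\<Sum>c<k. q c) \<le> card V"
  shows "\<exists>c<k. \<exists>I\<subseteq>V. card I = q c \<and> (\<forall>i\<in>I. \<forall>j\<in>I. i < j \<longrightarrow> g i j = c)"
  using assms(2-)
proof (induction "\<Sum>c<k. q c" arbitrary: q V)
  case 0
  then have "q 0 = 0" using assms(1) by simp
  then show ?case using assms(1) by (intro exI[of _ 0] conjI exI[of _ "{}"]) auto
next
  case (Suc s)
  note prems = Suc.prems
  show ?case
  proof (cases "\<exists>c<k. q c = 0")
    case True
    then obtain c where "c < k" "q c = 0" by blast
    then show ?thesis by (intro exI[of _ c] conjI exI[of _ "{}"]) auto
  next
    case False
    have V: "(k + 1) * (k + 1) ^ s \<le> card V" using prems(3) Suc.hyps(2)[symmetric] by simp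
    then have "card V \<noteq> 0" by (metis le_zero_eq mult_eq_0_iff power_eq_0_iff add_is_0 one_neq_zero)
    then have "V \<noteq> {}" by auto
    define v where "v = Min V"
    define W where "W = V - {v}"
    have v: "v \<in> V" "\<forall>w\<in>W. v < w"
      using \<open>V \<noteq> {}\<close> prems(1) by (auto simp: v_def W_def order.strict_iff_order)
    have "\<exists>c<k. (k + 1) ^ s \<le> card {w \<in> W. g v w = c}"
    proof (rule ccontr)
      assume "\<not> ?thesis"
      then have *: "card {w \<in> W. g v w = c} \<le> (k + 1) ^ s - 1" if "c < k" for c
        using that by fastforce
      have "W = (\<Union>c<k. {w \<in> W. g v w = c})" using v prems(2) by (auto simp: W_def)
      then have "card W \<le> (\<Sum>c<k. card {w \<in> W. g v w = c})"
        by (metis card_UN_le finite_lessThan)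
      also have "\<dots> \<le> k * ((k + 1) ^ s - 1)"
        using sum_bounded_above[of "{..<k}" "\<lambda>c. card {w \<in> W. g v w = c}" "(k + 1) ^ s - 1"] * by simp
      also have "\<dots> = k * (k + 1) ^ s - k" by (simp add: diff_mult_distrib2)
      finally have "card W \<le> k * (k + 1) ^ s - k" .
      moreover have "card W = card V - 1" using v(1) by (simp add: W_def prems(1))
      moreover have "(1::nat) \<le> (k + 1) ^ s" by simp
      moreover have "k * 1 \<le> k * (k + 1) ^ s" by (intro mult_le_mono) auto
      moreover have "(k + 1) * (k + 1) ^ s = k * (k + 1) ^ s + (k + 1) ^ s"
        by (simp add: algebra_simps)
      moreover define p q where "p = k * (k + 1) ^ s" and "q = (k + 1) ^ s"
      ultimately have "card W \<le> p - k" "card W = card V - 1" "1 \<le> q" "k \<le> p" "p + q \<le> card V"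
        using V by simp_all
      then show False using assms(1) by linarith
    qed
    then obtain c where c: "c < k" "(k + 1) ^ s \<le> card {w \<in> W. g v w = c}" by blast
    define q' where "q' = q(c := q c - 1)"
    have "q c \<noteq> 0" using False c(1) by simp
    have rem: "(\<Sum>d\<in>{..<k} - {c}. q' d) = (\<Sum>d\<in>{..<k} - {c}. q d)"
      by (intro sum.cong) (auto simp: q'_def)
    have q': "(\<Sum>d<k. q' d) = s"
      using Suc.hyps(2) \<open>q c \<noteq> 0\<close> sum.remove[of "{..<k}" c q] sum.remove[of "{..<k}" c q'] rem c(1)
      by (simp add: q'_def)
    have "\<exists>d<k. \<exists>I\<subseteq>{w \<in> W. g v w = c}. card I = q' d \<and> (\<forall>i\<in>I. \<forall>j\<in>I. i < j \<longrightarrow> g i j = d)"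
      using q' prems c(2) by (intro Suc.hyps(1)) (auto simp: W_def)
    then obtain d I where I: "d < k" "I \<subseteq> {w \<in> W. g v w = c}" "card I = q' d"
        "\<forall>i\<in>I. \<forall>j\<in>I. i < j \<longrightarrow> g i j = d"
      by blast
    show ?thesis
    proof (cases "d = c")
      case True
      have "v \<notin> I" "finite I" using I(2) prems(1) by (auto simp: W_def intro: finite_subset)
      then have "card (insert v I) = q c" using I(3) True \<open>q c \<noteq> 0\<close> by (simp add: q'_def)
      moreover have "\<forall>i\<in>insert v I. \<forall>j\<in>insert v I. i < j \<longrightarrow> g i j = c"
        using I v(2) True by fastforce
      moreover have "insert v I \<subseteq> V" using I(2) v(1) by (auto simp: W_def)
      ultimately show ?thesis using c(1) by blast
    next
      case False
      then have "card I = q d" using I(3) by (simp add: q'_def)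
      moreover have "I \<subseteq> V" using I(2) by (auto simp: W_def)
      ultimately show ?thesis using I(1,4) by blast
    qed
  qed
qed

lemma ram_power: "1 \<le> k \<Longrightarrow> ram k ((k + 1) ^ (k * r)) r"
  unfolding ram_def
proof (intro allI impI)
  fix g :: "nat \<Rightarrow> nat \<Rightarrow> nat"
  assume "1 \<le> k" "\<forall>i j. i < j \<longrightarrow> j < (k + 1) ^ (k * r) \<longrightarrow> g i j < k"
  then show "\<exists>c<k. \<exists>I\<subseteq>{..<(k + 1) ^ (k * r)}. card I = r \<and> (\<forall>i\<in>I. \<forall>j\<in>I. i < j \<longrightarrow> g i j = c)"
    using ramsey_asymmetric[of k "{..<(k + 1) ^ (k * r)}" g "\<lambda>_. r"] by simp
qed

text \<open>There is only one pair of indices below 2. Hence two blocks suffice at the top level,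
  where a single copy is wanted.\<close>

lemma ram_2: "ram k 2 2"
  unfolding ram_def
proof (intro allI impI)
  fix g :: "nat \<Rightarrow> nat \<Rightarrow> nat"
  assume "\<forall>i j. i < j \<longrightarrow> j < 2 \<longrightarrow> g i j < k"
  then have "g 0 1 < k" by simp
  moreover have "g i j = g 0 1" if "i < j" "j < 2" for i j
  proof -
    have "i = 0" "j = 1" using that by linarith+
    then show ?thesis by simp
  qed
  ultimately have "g 0 1 < k \<and> {..<2::nat} \<subseteq> {..<2} \<and> card {..<2::nat} = 2 \<and>
      (\<forall>i\<in>{..<2}. \<forall>j\<in>{..<2}. i < j \<longrightarrow> g i j = g 0 1)"
    by (metis card_lessThan lessThan_iff order_refl)
  then show "\<exists>c<k. \<exists>I\<subseteq>{..<2}. card I = 2 \<and> (\<forall>i\<in>I. \<forall>j\<in>I. i < j \<longrightarrow> g i j = c)"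
    by meson
qed

lemma ram_imp_le: "ram k N r \<Longrightarrow> 1 \<le> k \<Longrightarrow> r \<le> N"
proof -
  assume "ram k N r" "1 \<le> k"
  then obtain I where "I \<subseteq> {..<N}" "card I = r"
    unfolding ram_def by (elim allE[of _ "\<lambda>_ _. 0"]) auto
  then show ?thesis using card_mono[of "{..<N}" I] by simp
qed

text \<open>
  Each block is thinned twice by the partition lemma: first according to the colours its points
  receive from all points of the earlier blocks, then according to the colours its points give to
  the (already thinned) later blocks.
\<close>

lemma cross_homogeneous_blocks:
  fixes F :: "nat \<Rightarrow> nat \<Rightarrow> nat"
  assumes fin: "finite X" and sp: "sparse X" and k: "1 \<le> k"
    and F: "\<forall>x\<in>X. \<forall>y\<in>X. x < y \<longrightarrow> F x y < k"
    and lo: "\<forall>x\<in>X. 17 \<le> x \<and> k \<le> x \<and> (k + 1) ^ (2 * N) \<le> x"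
    and blk: "blk (lrg (Suc e)) N X"
  obtains A g where
    "\<And>i. i < N \<Longrightarrow> A i \<subseteq> X \<and> A i \<noteq> {}"
    "\<And>i j. i < j \<Longrightarrow> j < N \<Longrightarrow>
       before (A i) (A j) \<and> g i j < k \<and> (\<forall>p\<in>A i. \<forall>q\<in>A j. F p q = g i j)"
    "\<And>j. 0 < j \<Longrightarrow> j < N \<Longrightarrow>
       \<exists>y. (\<forall>i<j. \<forall>p\<in>A i. p \<le> y) \<and> N \<le> y \<and>
         blk (lrg e) ((k + 1) ^ (k * (2 * y))) (A j) \<and>
         (\<forall>q\<in>A j. (k + 1) ^ (2 * (k + 1) ^ (k * (2 * y))) \<le> q)"
proof -
  obtain Gs where Gs: "length Gs = N" "sorted_wrt before Gs"
      "\<forall>G\<in>set Gs. lrg (Suc e) G \<and> G \<subseteq> X"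
    using blk unfolding blk_def by blast
  have GX: "Gs ! i \<subseteq> X" if "i < N" for i using Gs(1,3) that nth_mem by blast
  have Gbef: "before (Gs ! i) (Gs ! j)" if "i < j" "j < N" for i j
    using Gs(1,2) that sorted_wrt_nth_less by blast
  have "\<exists>z. z \<in> Gs ! i \<and> blk (lrg e) z {q \<in> Gs ! i. z < q}" if "i < N" for i
  proof -
    have "lrg (Suc e) (Gs ! i)" using Gs(1,3) that nth_mem by blast
    then show ?thesis by auto
  qed
  then obtain z where z: "\<And>i. i < N \<Longrightarrow> z i \<in> Gs ! i \<and> blk (lrg e) (z i) {q \<in> Gs ! i. z i < q}"
    by metis
  have zX: "z i \<in> X" if "i < N" for i using z[OF that] GX[OF that] by blast
  \<comment> \<open>The heads are split off; only the subblocks behind them are thinned.\<close>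
  define C where "C i = {q \<in> Gs ! i. z i < q}" for i
  define P where "P j = (\<Union>i<j. C i)" for j
  \<comment> \<open>The predecessor of \<open>z j\<close> in \<open>X\<close>. It bounds
    \<open>P j\<close>, and sparseness gives \<open>hyp (y j) \<le> z j\<close>. For
    \<open>0 < j\<close> it exists, since \<open>z 0\<close> lies below \<open>z j\<close>.\<close>
  define y where "y j = Max {x \<in> X. x < z j}" for j
  have CX: "C i \<subseteq> X" if "i < N" for i using GX[OF that] by (auto simp: C_def)
  have PX: "P j \<subseteq> X" if "j < N" for j 
    unfolding P_def using CX that by (meson UN_least lessThan_iff less_trans)
  have finP: "finite (P j)" if "j < N" for j using PX[OF that] fin finite_subset by blast
  have Pz: "p < z j" if "p \<in> P j" "j < N" for p j
    using that Gbef z unfolding P_def C_def before_def by blast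
  have y: "y j \<in> X" "y j < z j" "hyp (y j) \<le> z j" "\<forall>p\<in>P j. p \<le> y j" if "0 < j" "j < N" for j
  proof -
    have "z 0 < z j" using Gbef[OF that] z that unfolding before_def by auto
    then have "z 0 \<in> {x \<in> X. x < z j}" using zX that by auto
    then have "y j \<in> {x \<in> X. x < z j}" unfolding y_def using fin by (intro Max_in) auto
    then show "y j \<in> X" "y j < z j" by auto
    then show "hyp (y j) \<le> z j" using sp zX[OF that(2)] unfolding sparse_def by blast
    show "\<forall>p\<in>P j. p \<le> y j" using PX[OF that(2)] Pz[OF _ that(2)] fin unfolding y_def by auto
  qed
  \<comment> \<open>The copies to be left in block \<open>j\<close>: the Ramsey number for
    \<open>2 * y j\<close>, from which \<open>y j\<close> copies of a homogeneous kind can later be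
    drawn. The first block only has to stay nonempty.\<close>
  define L where "L j = (if j = 0 then 1 else (k + 1) ^ (k * (2 * y j)))" for j
  \<comment> \<open>\<open>Da j\<close> bounds the number of colour vectors indexed by earlier
    points, \<open>Db\<close> the number of those indexed by blocks; each sorting costs the
    square.\<close>
  define Da where "Da j = k ^ card (P j)" for j
  define Db where "Db = k ^ N"
  have Db: "Db * Db \<le> x" if "x \<in> X" for x
  proof -
    have "Db * Db = k ^ (2 * N)" by (simp add: Db_def power_add[symmetric] mult_2)
    also have "\<dots> \<le> (k + 1) ^ (2 * N)" by (intro power_mono) auto
    also have "\<dots> \<le> x" using lo that by blast
    finally show ?thesis .
  qed
  have copies: "Da j * Da j * (Db * Db * L j) \<le> z j" if "j < N" for j
  proof (cases "j = 0")
    case True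
    then show ?thesis using Db[OF zX[OF that]] by (simp add: L_def Da_def P_def)
  next
    case False
    note yj = y[of j, OF _ that]
    have yX: "y j \<in> X" using yj(1) False by simp
    have "card (P j) \<le> y j"
    proof -
      \<comment> \<open>The elements are positive, so there are at most \<open>y j\<close> of them
        and not \<open>y j + 1\<close>.\<close>
      have "P j \<subseteq> {1..y j}" using yj(4) False PX[OF that] lo by fastforce
      then show ?thesis using card_mono[of "{1..y j}"] by fastforce
    qed
    have "Da j * Da j = k ^ (2 * card (P j))" by (simp add: Da_def power_add[symmetric] mult_2)
    also have "\<dots> \<le> k ^ (2 * y j)" using k \<open>card (P j) \<le> y j\<close> by (intro power_increasing) auto
    also have "\<dots> \<le> (k + 1) ^ (2 * y j)" by (intro power_mono) auto
    finally have "Da j * Da j * (Db * Db * L j) \<le>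
        (k + 1) ^ (2 * y j) * (y j * (k + 1) ^ (k * (2 * y j)))"
      using Db[OF yX] False by (intro mult_le_mono) (auto simp: L_def)
    also have "\<dots> \<le> hyp (y j)" using lo yX k by (intro hyp_bounds_copies) auto
    also have "\<dots> \<le> z j" using yj(3) False by simp
    finally show ?thesis .
  qed
  have Da: "Da j * Da j \<le> q" if "j < N" "q \<in> C j" for j q
  proof -
    have "0 < Db * Db * L j" using k by (simp add: Db_def L_def)
    then have "Da j * Da j * 1 \<le> Da j * Da j * (Db * Db * L j)" by (intro mult_le_mono) auto
    then have "Da j * Da j \<le> z j" using copies[OF that(1)] by linarith
    then show ?thesis using that(2) by (simp add: C_def)
  qed
  \<comment> \<open>First thinning: the points kept in \<open>C j\<close> receive the same colour
    from each \<open>p \<in> P j\<close>. Restricting to \<open>P j\<close> makes the colour vectors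
    range over a finite set.\<close>
  have ex_\<phi>: "\<exists>\<phi>. \<phi> \<in> P j \<rightarrow>\<^sub>E {..<k} \<and>
      blk (lrg e) (Db * Db * L j) {q \<in> C j. restrict (\<lambda>p. F p q) (P j) = \<phi>}" if "j < N" for j
  proof -
    have "sparse (C j)" using sp CX[OF that] sparse_subset by blast
    moreover have "\<forall>x\<in>C j. 17 \<le> x \<and> Da j * Da j \<le> x" using Da that lo CX[OF that] by blast
    moreover have "finite (P j \<rightarrow>\<^sub>E {..<k})" using finP[OF that] by (intro finite_PiE) auto
    moreover have "P j \<rightarrow>\<^sub>E {..<k} \<noteq> {}" using k by (simp add: PiE_eq_empty_iff lessThan_empty_iff)
    moreover have "card (P j \<rightarrow>\<^sub>E {..<k}) \<le> Da j" using finP[OF that] by (simp add: card_PiE Da_def)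
    moreover have "(\<lambda>q. restrict (\<lambda>p. F p q) (P j)) ` C j \<subseteq> P j \<rightarrow>\<^sub>E {..<k}"
    proof -
      have "F p q < k" if "p \<in> P j" "q \<in> C j" for p q
        using F PX CX Pz that \<open>j < N\<close> by (fastforce simp: C_def)
      then show ?thesis by auto
    qed
    moreover have "blk (lrg e) (Da j * Da j * (Db * Db * L j)) (C j)"
      using z[OF that] copies[OF that] unfolding C_def by (auto intro: blk_mono)
    ultimately obtain \<phi> where "\<phi> \<in> P j \<rightarrow>\<^sub>E {..<k}"
        "blk (lrg e) (Db * Db * L j) {q \<in> C j. restrict (\<lambda>p. F p q) (P j) = \<phi>}"
      by (rule partition_blk)
    then show ?thesis by (intro exI[of _ \<phi>] conjI)
  qed
  define \<phi> where "\<phi> j = (SOME \<phi>. \<phi> \<in> P j \<rightarrow>\<^sub>E {..<k} \<and>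
      blk (lrg e) (Db * Db * L j) {q \<in> C j. restrict (\<lambda>p. F p q) (P j) = \<phi>})" for j
  have "\<phi> j \<in> P j \<rightarrow>\<^sub>E {..<k} \<and>
      blk (lrg e) (Db * Db * L j) {q \<in> C j. restrict (\<lambda>p. F p q) (P j) = \<phi> j}" if "j < N" for j
    unfolding \<phi>_def by (rule someI_ex[OF ex_\<phi>[OF that]])
  note \<phi> = conjunct1[OF this] conjunct2[OF this]
  define C' where "C' j = {q \<in> C j. restrict (\<lambda>p. F p q) (P j) = \<phi> j}" for j
  have C'C: "C' j \<subseteq> C j" for j by (auto simp: C'_def)
  \<comment> \<open>After the first thinning, the colour of \<open>p\<close> towards
    \<open>C' j\<close> is the single value \<open>\<phi> j p\<close>. Entries with
    \<open>j \<le> i\<close> get the dummy colour 0, which is below \<open>k\<close>.\<close>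
  define t where "t i p = restrict (\<lambda>j. if i < j then \<phi> j p else 0) {..<N}" for i p
  have CP: "p \<in> P j" if "p \<in> C i" "i < j" for i j p using that by (auto simp: P_def)
  have ex_\<psi>: "\<exists>\<psi>. \<psi> \<in> {..<N} \<rightarrow>\<^sub>E {..<k} \<and> blk (lrg e) (L i) {p \<in> C' i. t i p = \<psi>}" if "i < N" for i
  proof -
    have C'X: "C' i \<subseteq> X" using C'C CX[OF that] by blast
    then have "sparse (C' i)" using sp sparse_subset by blast
    moreover have "\<forall>x\<in>C' i. 17 \<le> x \<and> Db * Db \<le> x" using Db lo C'X by blast
    moreover have "finite ({..<N} \<rightarrow>\<^sub>E {..<k})" by (intro finite_PiE) auto
    moreover have "{..<N} \<rightarrow>\<^sub>E {..<k} \<noteq> {}" using k by (simp add: PiE_eq_empty_iff lessThan_empty_iff)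
    moreover have "card ({..<N} \<rightarrow>\<^sub>E {..<k}) \<le> Db" by (simp add: card_PiE Db_def)
    moreover have "t i ` C' i \<subseteq> {..<N} \<rightarrow>\<^sub>E {..<k}"
    proof -
      have "\<phi> j p < k" if "p \<in> C' i" "i < j" "j < N" for p j
        using \<phi>(1)[OF that(3)] CP[of p i j] that C'C by (auto simp: PiE_def Pi_def)
      then show ?thesis using k unfolding t_def image_subset_iff restrict_PiE_iff by auto
    qed
    moreover have "blk (lrg e) (Db * Db * L i) (C' i)" using \<phi>(2)[OF that] by (simp add: C'_def)
    ultimately obtain \<psi> where "\<psi> \<in> {..<N} \<rightarrow>\<^sub>E {..<k}"
        "blk (lrg e) (L i) {p \<in> C' i. t i p = \<psi>}"
      by (rule partition_blk)
    then show ?thesis by (intro exI[of _ \<psi>] conjI)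
  qed
  define \<psi> where "\<psi> i = (SOME \<psi>. \<psi> \<in> {..<N} \<rightarrow>\<^sub>E {..<k} \<and>
      blk (lrg e) (L i) {p \<in> C' i. t i p = \<psi>})" for i
  have "\<psi> i \<in> {..<N} \<rightarrow>\<^sub>E {..<k} \<and> blk (lrg e) (L i) {p \<in> C' i. t i p = \<psi> i}" if "i < N" for i
    unfolding \<psi>_def by (rule someI_ex[OF ex_\<psi>[OF that]])
  note \<psi> = conjunct1[OF this] conjunct2[OF this]
  define A where "A i = {p \<in> C' i. t i p = \<psi> i}" for i
  have AC: "A i \<subseteq> C i" for i using C'C by (auto simp: A_def)
  show thesis
  \<comment> \<open>The vectors fixed by the second thinning serve as the colouring of pairs of
    blocks.\<close>
  proof (rule that[of A \<psi>])
    fix i assume i: "i < N"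
    have "blk (lrg e) (Suc 0) (A i)"
      using blk_mono[OF \<psi>(2)[OF i] order_refl, of "Suc 0"] by (simp add: A_def L_def Suc_le_eq)
    then have "A i \<noteq> {}" using lrg_nonempty by auto
    then show "A i \<subseteq> X \<and> A i \<noteq> {}" using AC CX[OF i] by blast
  next
    fix i j assume ij: "i < j" "j < N"
    have "F p q = \<psi> i j" if "p \<in> A i" "q \<in> A j" for p q
    proof -
      have p: "p \<in> P j" using CP ij(1) that(1) AC by blast
      have "restrict (\<lambda>p. F p q) (P j) = \<phi> j" using that(2) by (auto simp: A_def C'_def)
      then have "F p q = \<phi> j p" using p by (metis restrict_apply')
      also have "\<dots> = t i p j" using ij by (simp add: t_def)
      also have "\<dots> = \<psi> i j" using that(1) by (simp add: A_def)
      finally show ?thesis .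
    qed
    moreover have "\<psi> i j < k" using \<psi>(1)[of i] ij by (auto simp: PiE_def Pi_def)
    moreover have "before (A i) (A j)"
      using before_mono[OF Gbef[OF ij]] AC unfolding C_def by blast
    ultimately show "before (A i) (A j) \<and> \<psi> i j < k \<and> (\<forall>p\<in>A i. \<forall>q\<in>A j. F p q = \<psi> i j)"
      by blast
  next
    fix j assume j: "0 < j" "j < N"
    note yj = y[OF j]
    have "(k + 1) ^ (2 * (k + 1) ^ (k * (2 * y j))) \<le> q" if "q \<in> A j" for q
    proof -
      have "(k + 1) ^ (2 * (k + 1) ^ (k * (2 * y j))) \<le> hyp (y j)"
        using lo yj(1) by (intro hyp_bounds_min) auto
      also have "\<dots> \<le> z j" by (rule yj(3))
      also have "\<dots> \<le> q" using subsetD[OF AC that] by (simp add: C_def)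
      finally show ?thesis .
    qed
    moreover have "blk (lrg e) ((k + 1) ^ (k * (2 * y j))) (A j)"
      using \<psi>(2)[OF j(2)] j(1) by (simp add: A_def L_def)
    moreover have "p \<le> y j" if "i < j" "p \<in> A i" for i p
      using yj(4) CP[of p i j] that AC by blast
    moreover have "N \<le> y j"
    proof -
      have "2 * N < (k + 1) ^ (2 * N)"
        using less_exp[of "2 * N"] power_mono[of 2 "k + 1" "2 * N"] k by linarith
      then show ?thesis using lo yj(1) by fastforce
    qed
    ultimately show "\<exists>y. (\<forall>i<j. \<forall>p\<in>A i. p \<le> y) \<and> N \<le> y \<and>
         blk (lrg e) ((k + 1) ^ (k * (2 * y))) (A j) \<and>
         (\<forall>q\<in>A j. (k + 1) ^ (2 * (k + 1) ^ (k * (2 * y))) \<le> q)"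
      by blast
  qed
qed

subsection \<open>Homogeneous sets\<close>

definition homog :: "(nat \<Rightarrow> nat \<Rightarrow> nat) \<Rightarrow> nat \<Rightarrow> nat set \<Rightarrow> bool" where
  "homog F c H \<longleftrightarrow> (\<forall>x\<in>H. \<forall>y\<in>H. x < y \<longrightarrow> F x y = c)"

lemma blk_indexed:
  fixes I :: "nat set"
  assumes "finite I" "\<And>i. i \<in> I \<Longrightarrow> P (G i) \<and> G i \<subseteq> X"
    and "\<And>i j. i \<in> I \<Longrightarrow> j \<in> I \<Longrightarrow> i < j \<Longrightarrow> before (G i) (G j)"
  shows "blk P (card I) X"
proof -
  let ?l = "sorted_list_of_set I"
  have "sorted_wrt (\<lambda>i j. before (G i) (G j)) ?l"
    by (rule sorted_wrt_mono_rel[OF _ strict_sorted_list_of_set]) (use assms in auto)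
  then have "sorted_wrt before (map G ?l)" by (simp add: sorted_wrt_map)
  then show ?thesis unfolding blk_def
    using assms(1,2) by (intro exI[of _ "map G ?l"]) auto
qed

text \<open>For exponent zero, one representative from each chosen block is enough.\<close>

lemma homog_points:
  fixes I :: "nat set"
  assumes "finite I" "\<And>i j. i \<in> I \<Longrightarrow> j \<in> I \<Longrightarrow> i < j \<Longrightarrow> p i < p j \<and> F (p i) (p j) = c"
  shows "homog F c (p ` I)" "blk (lrg 0) (card I) (p ` I)"
proof -
  have "F (p i) (p j) = c" if "i \<in> I" "j \<in> I" "p i < p j" for i j
    using that assms(2)[of i j] assms(2)[of j i] by (metis less_asym less_irrefl linorder_neqE_nat)
  then show "homog F c (p ` I)" unfolding homog_def by blast
  show "blk (lrg 0) (card I) (p ` I)"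
    using assms by (intro blk_indexed[where G = "\<lambda>i. {p i}"]) (auto simp: before_def)
qed

text \<open>
  Heads are the reason for asking for \<open>M\<close> copies of \<open>\<omega>\<^bsup>m c\<^esup>\<close>: a head \<open>v\<close> of colour \<open>c\<close> towards a later
  block is completed inside that block to a set that is large for \<open>\<omega>\<^bsup>m c\<^esup>\<close>, by applying the
  induction hypothesis there with \<open>m c\<close> lowered by one and with at least \<open>v\<close> copies.
\<close>

lemma homogeneous_blk:
  fixes F :: "nat \<Rightarrow> nat \<Rightarrow> nat"
  assumes k: "1 \<le> k"
    and "finite X" "sparse X" "\<forall>x\<in>X. \<forall>y\<in>X. x < y \<longrightarrow> F x y < k"
    and "\<forall>x\<in>X. 17 \<le> x \<and> k \<le> x \<and> (k + 1) ^ (2 * N) \<le> x"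
    and "(\<Sum>c<k. m c) = e" "ram k N (2 * M)" "blk (lrg e) N X"
  shows "\<exists>c<k. \<exists>H\<subseteq>X. homog F c H \<and> blk (lrg (m c)) M H"
  using assms(2-)
proof (induction e arbitrary: X m N M)
  \<comment> \<open>All \<open>m c\<close> with \<open>c < k\<close> vanish, so one point per block
    suffices, and the Ramsey property yields \<open>2 * M\<close> points of one colour.\<close>
  case 0
  obtain Gs where Gs: "length Gs = N" "sorted_wrt before Gs" "\<forall>G\<in>set Gs. lrg 0 G \<and> G \<subseteq> X"
    using 0(7) unfolding blk_def by blast
  have "\<exists>p. p \<in> Gs ! i \<and> p \<in> X" if "i < N" for i
  proof -
    have "lrg 0 (Gs ! i)" "Gs ! i \<subseteq> X" using Gs that nth_mem by blast+
    then show ?thesis by auto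
  qed
  then obtain p where p: "\<And>i. i < N \<Longrightarrow> p i \<in> Gs ! i \<and> p i \<in> X" by metis
  have pm: "p i < p j" if "i < j" "j < N" for i j
  proof -
    have "before (Gs ! i) (Gs ! j)" using Gs(1,2) that sorted_wrt_nth_less by blast
    then show ?thesis using p[of i] p[of j] that unfolding before_def by auto
  qed
  have "\<forall>i j. i < j \<longrightarrow> j < N \<longrightarrow> F (p i) (p j) < k"
  proof (intro allI impI)
    fix i j assume "i < j" "j < N"
    then show "F (p i) (p j) < k" using 0(3) p[of i] p[of j] pm[of i j] by auto
  qed
  then obtain c I where c: "c < k" "I \<subseteq> {..<N}" "card I = 2 * M"
      "\<forall>i\<in>I. \<forall>j\<in>I. i < j \<longrightarrow> F (p i) (p j) = c"
    using 0(6) unfolding ram_def by (elim allE[of _ "\<lambda>i j. F (p i) (p j)"]) blast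
  have "finite I" using c(2) finite_subset by blast
  moreover have "p i < p j \<and> F (p i) (p j) = c" if "i \<in> I" "j \<in> I" "i < j" for i j
    using that c(2,4) pm[of i j] by blast
  ultimately have "homog F c (p ` I)" "blk (lrg 0) (2 * M) (p ` I)"
    using homog_points[of I p F c] c(3) by auto
  moreover have "m c = 0" using 0(5) c(1) by simp
  moreover have "p ` I \<subseteq> X" using p c(2) by blast
  ultimately have "c < k \<and> p ` I \<subseteq> X \<and> homog F c (p ` I) \<and> blk (lrg (m c)) M (p ` I)"
    using c(1) blk_mono[of "lrg 0" "2 * M" "p ` I" "p ` I" M] by simp
  then show ?case by blast
next
  case (Suc e)
  obtain A g where A: "\<And>i. i < N \<Longrightarrow> A i \<subseteq> X \<and> A i \<noteq> {}"
    and Ag: "\<And>i j. i < j \<Longrightarrow> j < N \<Longrightarrow>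
       before (A i) (A j) \<and> g i j < k \<and> (\<forall>p\<in>A i. \<forall>q\<in>A j. F p q = g i j)"
    and Ay: "\<And>j. 0 < j \<Longrightarrow> j < N \<Longrightarrow>
       \<exists>y. (\<forall>i<j. \<forall>p\<in>A i. p \<le> y) \<and> N \<le> y \<and>
         blk (lrg e) ((k + 1) ^ (k * (2 * y))) (A j) \<and>
         (\<forall>q\<in>A j. (k + 1) ^ (2 * (k + 1) ^ (k * (2 * y))) \<le> q)"
    by (rule cross_homogeneous_blocks[OF Suc.prems(1,2) k Suc.prems(3,4,7)]) blast
  have "\<forall>i j. i < j \<longrightarrow> j < N \<longrightarrow> g i j < k" using Ag by blast
  then obtain c I where c: "c < k" "I \<subseteq> {..<N}" "card I = 2 * M"
      "\<forall>i\<in>I. \<forall>j\<in>I. i < j \<longrightarrow> g i j = c"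
    using Suc.prems(6) unfolding ram_def by (elim allE[of _ g]) blast
  have finI: "finite I" using c(2) finite_subset by blast
  have cross: "before (A i) (A j) \<and> (\<forall>p\<in>A i. \<forall>q\<in>A j. F p q = c)"
    if "i \<in> I" "j \<in> I" "i < j" for i j
    using Ag[of i j] c(2,4) that by auto
  have AX: "A i \<subseteq> X" "A i \<noteq> {}" if "i \<in> I" for i using A[of i] that c(2) by auto
  define p where "p i = (SOME a. a \<in> A i)" for i
  have p: "p i \<in> A i" if "i \<in> I" for i using AX(2)[OF that] by (simp add: p_def some_in_eq)
  show ?case
  proof (cases "m c")
    case 0
    have "p i < p j \<and> F (p i) (p j) = c" if "i \<in> I" "j \<in> I" "i < j" for i j
      using cross[OF that] p that unfolding before_def by blast
    then have "homog F c (p ` I)" "blk (lrg 0) (2 * M) (p ` I)"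
      using homog_points[of I p F c] finI c(3) by auto
    moreover have "p ` I \<subseteq> X" using p AX(1) by blast
    ultimately have "c < k \<and> p ` I \<subseteq> X \<and> homog F c (p ` I) \<and> blk (lrg (m c)) M (p ` I)"
      using c(1) 0 blk_mono[of "lrg 0" "2 * M" "p ` I" "p ` I" M] by simp
    then show ?thesis by blast
  next
    case mc: (Suc m0)
    define m' where "m' = m(c := m0)"
    have "(\<Sum>d\<in>{..<k} - {c}. m' d) = (\<Sum>d\<in>{..<k} - {c}. m d)"
      by (intro sum.cong) (auto simp: m'_def)
    then have m': "(\<Sum>d<k. m' d) = e"
      using Suc.prems(5) mc sum.remove[of "{..<k}" c m] sum.remove[of "{..<k}" c m'] c(1)
      by (simp add: m'_def)
    \<comment> \<open>The \<open>2 * M\<close> chosen blocks are paired: position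
      \<open>2 * t\<close> supplies a head and position \<open>2 * t + 1\<close> its body. This is
      the source of the factor 2 in the Ramsey hypothesis.\<close>
    define l where "l = sorted_list_of_set I"
    have l: "length l = 2 * M" "set l = I" "sorted_wrt (<) l"
      using finI c(3) by (auto simp: l_def)
    have lI: "l ! a \<in> I" if "a < 2 * M" for a using l that nth_mem by metis
    have lm: "l ! a < l ! b" if "a < b" "b < 2 * M" for a b
      using l that sorted_wrt_nth_less by metis
    have "2 * M \<le> N" using ram_imp_le[OF Suc.prems(6) k] .
    \<comment> \<open>Requesting \<open>y\<close> copies covers both outcomes: \<open>y\<close>
      bounds every candidate head, so a body of colour \<open>c\<close> is long enough, and
      \<open>M \<le> y\<close> is enough for any other colour.\<close>
    have ex: "\<exists>d H y. d < k \<and> H \<subseteq> A (l ! (2 * t + 1)) \<and> homog F d H \<and> blk (lrg (m' d)) y H \<and>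
        (\<forall>p\<in>A (l ! (2 * t)). p \<le> y) \<and> M \<le> y" if "t < M" for t
    proof -
      define i j where "i = l ! (2 * t)" and "j = l ! (2 * t + 1)"
      have ij: "i < j" "i \<in> I" "j \<in> I" using lI lm that by (auto simp: i_def j_def)
      then have "0 < j" "j < N" using c(2) by auto
      then obtain y where y: "\<forall>i<j. \<forall>p\<in>A i. p \<le> y" "N \<le> y"
          "blk (lrg e) ((k + 1) ^ (k * (2 * y))) (A j)"
          "\<forall>q\<in>A j. (k + 1) ^ (2 * (k + 1) ^ (k * (2 * y))) \<le> q"
        using Ay by blast
      have "\<exists>d<k. \<exists>H\<subseteq>A j. homog F d H \<and> blk (lrg (m' d)) y H"
      proof (rule Suc.IH[OF _ _ _ _ m' _ y(3)])
        show "finite (A j)" using AX(1)[OF ij(3)] Suc.prems(1) finite_subset by blast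
        show "sparse (A j)" using AX(1)[OF ij(3)] Suc.prems(2) sparse_subset by blast
        show "\<forall>x\<in>A j. \<forall>y\<in>A j. x < y \<longrightarrow> F x y < k" using AX(1)[OF ij(3)] Suc.prems(3) by blast
        show "\<forall>x\<in>A j. 17 \<le> x \<and> k \<le> x \<and> (k + 1) ^ (2 * (k + 1) ^ (k * (2 * y))) \<le> x"
          using AX(1)[OF ij(3)] Suc.prems(4) y(4) by blast
        show "ram k ((k + 1) ^ (k * (2 * y))) (2 * y)" using k by (rule ram_power)
      qed
      then obtain d H where "d < k" "H \<subseteq> A j" "homog F d H" "blk (lrg (m' d)) y H" by blast
      moreover have "\<forall>p\<in>A i. p \<le> y" using y(1) ij(1) by blast
      moreover have "M \<le> y" using y(2) \<open>2 * M \<le> N\<close> by linarith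
      ultimately show ?thesis unfolding i_def j_def by blast
    qed
    show ?thesis
    proof (cases "\<exists>t<M. \<exists>d H y. d \<noteq> c \<and> d < k \<and> H \<subseteq> A (l ! (2 * t + 1)) \<and> homog F d H \<and>
        blk (lrg (m' d)) y H \<and> M \<le> y")
      \<comment> \<open>A colour \<open>d \<noteq> c\<close> has the same exponent in
        \<open>m'\<close> as in \<open>m\<close>, so one block already contains the desired
        set.\<close>
      case True
      then obtain t d H y where *: "t < M" "d \<noteq> c" "d < k" "H \<subseteq> A (l ! (2 * t + 1))"
          "homog F d H" "blk (lrg (m' d)) y H" "M \<le> y"
        by blast
      have "H \<subseteq> X" using *(1,4) AX(1)[OF lI, of "2 * t + 1"] by auto
      moreover have "blk (lrg (m d)) M H"
        using blk_mono[OF *(6) order_refl *(7)] *(2) by (simp add: m'_def)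
      ultimately show ?thesis using *(3,5) by blast
    next
      case False
      define v where "v t = p (l ! (2 * t))" for t
      have vA: "v t \<in> A (l ! (2 * t))" if "t < M" for t
        using p lI that by (simp add: v_def)
      have ex_H: "\<exists>H. H \<subseteq> A (l ! (2 * t + 1)) \<and> homog F c H \<and> blk (lrg m0) (v t) H"
        if t: "t < M" for t
      proof -
        obtain d H y where *: "d < k" "H \<subseteq> A (l ! (2 * t + 1))" "homog F d H"
            "blk (lrg (m' d)) y H" "\<forall>p\<in>A (l ! (2 * t)). p \<le> y" "M \<le> y"
          using ex[OF t] by blast
        then have "d = c" using False t by blast
        moreover have "v t \<le> y" using *(5) vA[OF t] by blast
        ultimately show ?thesis
          using *(2,3) blk_mono[OF *(4) order_refl] by (intro exI[of _ H]) (simp add: m'_def)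
      qed
      define H where "H t =
        (SOME H. H \<subseteq> A (l ! (2 * t + 1)) \<and> homog F c H \<and> blk (lrg m0) (v t) H)" for t
      have Hy: "H t \<subseteq> A (l ! (2 * t + 1)) \<and> homog F c (H t) \<and> blk (lrg m0) (v t) (H t)"
        if "t < M" for t
        unfolding H_def by (rule someI_ex[OF ex_H[OF that]])
      define G where "G t = insert (v t) (H t)" for t
      have cr: "a < b \<and> F a b = c" if "a \<in> A (l ! s)" "b \<in> A (l ! t)" "s < t" "t < 2 * M" for a b s t
        using cross[OF lI lI lm, of s t] that unfolding before_def by auto
      have vH: "v t < h \<and> F (v t) h = c" if "t < M" "h \<in> H t" for t h
        using cr[OF vA, of t h "2 * t + 1"] Hy[OF that(1)] that by auto
      have lrgG: "lrg (m c) (G t)" if "t < M" for t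
      proof -
        have "blk (lrg m0) (v t) (H t)" using Hy[OF that] by (elim conjE)
        moreover have "H t \<subseteq> {x \<in> G t. v t < x}" using vH[OF that] by (auto simp: G_def)
        ultimately have "blk (lrg m0) (v t) {x \<in> G t. v t < x}" using blk_mono by blast
        then show ?thesis by (auto simp: mc G_def)
      qed
      have GG: "a < b \<and> F a b = c" if "s < t" "t < M" "a \<in> G s" "b \<in> G t" for a b s t
      proof -
        have "a \<in> A (l ! (2 * s)) \<or> a \<in> A (l ! (2 * s + 1))"
          using that Hy[of s] vA[of s] by (auto simp: G_def)
        moreover have "b \<in> A (l ! (2 * t)) \<or> b \<in> A (l ! (2 * t + 1))"
          using that Hy[of t] vA[of t] by (auto simp: G_def)
        ultimately show ?thesis
          using that(1,2) cr[of a "2 * s" b "2 * t"] cr[of a "2 * s + 1" b "2 * t"]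
            cr[of a "2 * s" b "2 * t + 1"] cr[of a "2 * s + 1" b "2 * t + 1"] by auto
      qed
      have "blk (lrg (m c)) (card {..<M}) (\<Union>t<M. G t)"
      proof (rule blk_indexed[where G = G])
        show "lrg (m c) (G t) \<and> G t \<subseteq> (\<Union>t<M. G t)" if "t \<in> {..<M}" for t
          using lrgG[of t] that by blast
        show "before (G s) (G t)" if "s \<in> {..<M}" "t \<in> {..<M}" "s < t" for s t
          unfolding before_def using GG[OF that(3)] that(2) by blast
      qed simp
      moreover have "homog F c (\<Union>t<M. G t)"
        unfolding homog_def
      proof (intro ballI impI)
        fix a b assume ab: "a \<in> (\<Union>t<M. G t)" "b \<in> (\<Union>t<M. G t)" "a < b"
        then obtain s t where st: "s < M" "t < M" "a \<in> G s" "b \<in> G t" by blast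
        consider "s < t" | "s = t" | "t < s" by linarith
        then show "F a b = c"
        proof cases
          case 2
          then have "a = v t \<or> a \<in> H t" "b = v t \<or> b \<in> H t" using st by (auto simp: G_def)
          then show ?thesis
            using ab(3) vH[OF st(2)] Hy[OF st(2)] unfolding homog_def by (metis less_asym less_irrefl)
        qed (use GG[of s t a b] GG[of t s b a] st ab in auto)
      qed
      moreover have "(\<Union>t<M. G t) \<subseteq> X"
      proof -
        have "G t \<subseteq> X" if "t < M" for t
          using Hy[OF that] vA[OF that] AX(1)[OF lI, of "2 * t"] AX(1)[OF lI, of "2 * t + 1"] that
          by (auto simp: G_def)
        then show ?thesis by blast
      qed
      ultimately show ?thesis using c(1) by auto
    qed
  qed
qed

section \<open>Assembly from ten blocks of exponent \<open>k * n + 2\<close>\<close>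

theorem theorem2:
  fixes n k :: nat and X :: "nat set"
  assumes "n \<ge> 1" and "k \<ge> 1"
    and "finite X"
    and "large (omega_pow (ord_of_nat (k * n + 3))) X"
    and "Min X \<ge> 17"
  shows "RT2_large k (omega_pow (ord_of_nat n)) X"
  unfolding RT2_large_def
proof
  fix f assume f: "f \<in> [X]\<^bsup>2\<^esup> \<rightarrow> {..<k}"
  define F where "F x y = f {x, y}" for x y
  define L where "L = lrg (Suc (Suc (k * n)))"
  have X17: "\<forall>x\<in>X. 17 \<le> x" using assms(3,5) by (meson Min_le order.trans)
  have "lrg (Suc (Suc (Suc (k * n)))) X"
    using large_imp_lrg[OF assms(4)] by (simp only: add_Suc_right add_0_right numeral_3_eq_3)
  then obtain x where x: "x \<in> X" "blk L x {y \<in> X. x < y}" unfolding L_def by auto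
  have "17 \<le> x" using X17 x(1) by blast
  \<comment> \<open>The head \<open>x \<ge> 17\<close> affords ten blocks: three to climb past
    \<open>(k + 1) ^ 4\<close>, two for a sparse set, three as a spacer, and two for a second sparse
    set.\<close>
  then have "blk L (3 + (2 + (3 + 2))) {y \<in> X. x < y}" by (intro blk_mono[OF x(2)]) auto
  then obtain S0 R0 where S0: "S0 \<subseteq> {y \<in> X. x < y}" "R0 \<subseteq> {y \<in> X. x < y}" "before S0 R0"
      "blk L 3 S0" "blk L (2 + (3 + 2)) R0"
    by (rule blk_add)
  obtain S1 R1 where S1: "S1 \<subseteq> R0" "R1 \<subseteq> R0" "before S1 R1" "blk L 2 S1" "blk L (3 + 2) R1"
    using S0(5) by (rule blk_add)
  obtain S2 S3 where S2: "S2 \<subseteq> R1" "S3 \<subseteq> R1" "before S2 S3" "blk L 3 S2" "blk L 2 S3"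
    using S1(5) by (rule blk_add)
  \<comment> \<open>Since \<open>k\<close> may be far above 17, it must be overtaken first: the
    exponent \<open>k * n + 2\<close> forces some \<open>b \<ge> k\<close> in the first of the three
    blocks, and the other two add an exponential each.\<close>
  have R0: "17 \<le> y \<and> k \<le> y \<and> (k + 1) ^ (2 * 2) \<le> y" if "y \<in> R0" for y
  proof -
    have "blk L (Suc (Suc (Suc 0))) S0" using S0(4) by (simp only: numeral_3_eq_3)
    then obtain B C where BC: "B \<subseteq> S0" "C \<subseteq> S0" "before B C" "L B" "blk L (Suc (Suc 0)) C"
      by (rule blk_Suc)
    obtain D E where DE: "D \<subseteq> C" "E \<subseteq> C" "before D E" "L D" "blk L (Suc 0) E"
      using BC(5) by (rule blk_Suc)
    have "\<forall>d\<in>B. 17 < d" using BC(1) S0(1) \<open>17 \<le> x\<close> by auto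
    then obtain b where b: "b \<in> B" "17 + Suc (Suc (k * n)) < b"
      using lrg_growth_exponent[of "Suc (Suc (k * n))" B 17] BC(4) unfolding L_def by blast
    have "k * 1 \<le> k * n" using assms(1) by (intro mult_le_mono) auto
    then have "k \<le> b" "17 \<le> b" using b(2) by linarith+
    have "\<forall>d\<in>D. b < d" using b(1) BC(3) DE(1) unfolding before_def by blast
    then obtain d where d: "d \<in> D" "2 ^ b \<le> d"
      using lrg_growth_exp[of "k * n" D b] DE(4) unfolding L_def by blast
    obtain G where G: "G \<subseteq> E" "L G" using DE(5) by auto
    have "\<forall>u\<in>G. d < u" using d(1) DE(3) G(1) unfolding before_def by blast
    then obtain u where u: "u \<in> G" "2 ^ d \<le> u"
      using lrg_growth_exp[of "k * n" G d] G(2) unfolding L_def by blast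
    have "u < y" using u(1) G(1) DE(2) BC(2) S0(3) that unfolding before_def by blast
    have "k * 4 \<le> 6 * b ^ 3"
    proof -
      have "4 * b * 1 \<le> 6 * b * (b * b)" using \<open>17 \<le> b\<close> by (intro mult_le_mono) auto
      then have "4 * b \<le> 6 * b ^ 3" by (simp add: power3_eq_cube)
      then show ?thesis using \<open>k \<le> b\<close> by linarith
    qed
    then have "k * 4 \<le> d" using cube_le_power[OF \<open>17 \<le> b\<close>] d(2) by linarith
    then have "(2::nat) ^ (k * 4) \<le> 2 ^ d" by (intro power_increasing) auto
    then have "(k + 1) ^ 4 \<le> y"
      using Suc_power_le_two_power[of k 4] u(2) \<open>u < y\<close> by linarith
    moreover have "17 \<le> y" using that S0(2) X17 by blast
    moreover have "k \<le> y" using \<open>k * 4 \<le> d\<close> u(2) \<open>u < y\<close> less_exp[of d] by linarith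
    ultimately show ?thesis by simp
  qed
  obtain A where A: "A \<subseteq> S1" "sparse A" "lrg (k * n) A"
    using sparse_lrg_subset[of "k * n" S1] S1(4) S1(1) R0 unfolding L_def by blast
  obtain B where B: "B \<subseteq> S3" "sparse B" "lrg (k * n) B"
    using sparse_lrg_subset[of "k * n" S3] S2(5) S2(2) S1(2) R0 unfolding L_def by blast
  have AB: "before A S2" "before S2 B" "before A B"
    using A(1) B(1) S1(3) S2(1,2,3) unfolding before_def by blast+
  define Y where "Y = A \<union> B"
  have YR: "Y \<subseteq> R0" using A(1) B(1) S1(1,2) S2(2) by (auto simp: Y_def)
  then have YX: "Y \<subseteq> X" using S0(2) by blast
  have "\<exists>c<k. \<exists>H\<subseteq>Y. homog F c H \<and> blk (lrg n) 1 H"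
  proof (rule homogeneous_blk[OF assms(2)])
    show "finite Y" using YX assms(3) finite_subset by blast
    show "sparse Y" unfolding Y_def
      using sparse_Un[OF A(2) B(2) AB(3)] hyp_gap[OF _ AB(1,2)] S2(4) unfolding L_def by blast
    show "\<forall>x\<in>Y. \<forall>y\<in>Y. x < y \<longrightarrow> F x y < k"
    proof (intro ballI impI)
      fix x y assume "x \<in> Y" "y \<in> Y" "x < y"
      then have "{x, y} \<in> [X]\<^bsup>2\<^esup>" using YX by (auto simp: nsets_def)
      then show "F x y < k" using f by (auto simp: F_def)
    qed
    show "\<forall>x\<in>Y. 17 \<le> x \<and> k \<le> x \<and> (k + 1) ^ (2 * 2) \<le> x" using R0 YR by blast
    show "(\<Sum>c<k. n) = k * n" by simp
    show "ram k 2 (2 * 1)" using ram_2 by simp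
    have "blk (lrg (k * n)) (1 + 1) Y"
      unfolding Y_def using A(3) B(3) AB(3) by (intro blk_Un) auto
    then show "blk (lrg (k * n)) 2 Y" by (simp add: numeral_2_eq_2)
  qed
  then obtain c H where H: "H \<subseteq> Y" "homog F c H" "blk (lrg n) 1 H" by blast
  then obtain G where "G \<subseteq> H" "lrg n G" by auto
  then obtain H' where H': "H' \<subseteq> G" "large (omega_pow (ord_of_nat n)) H'"
    using lrg_imp_large by blast
  have "f e = c" if "e \<in> [H']\<^bsup>2\<^esup>" for e
  proof -
    obtain a b where e: "e = {a, b}" "a \<noteq> b" "a \<in> H'" "b \<in> H'"
      using \<open>e \<in> [H']\<^bsup>2\<^esup>\<close> by (auto simp: nsets_def card_2_iff)
    have "a \<in> H" "b \<in> H" using e H'(1) \<open>G \<subseteq> H\<close> by blast+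
    then show ?thesis
      using H(2) e(1,2) unfolding homog_def F_def by (metis insert_commute linorder_neqE_nat)
  qed
  then show "\<exists>H\<subseteq>X. large (omega_pow (ord_of_nat n)) H \<and> (\<exists>c. \<forall>e\<in>[H]\<^bsup>2\<^esup>. f e = c)"
    using H' H(1) YX \<open>G \<subseteq> H\<close> by (intro exI[of _ H']) blast
qed

end
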